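(* There exist $\varepsilon > 0$ and $n_0 \in \mathbb{N}$ such that the following holds for all integers $n \ge n_0$ that are divisible by $3$. Suppose $H$ is a $3$-uniform hypergraph on $n$ vertices with no isolated vertex and $\sigma_2'(H) > \frac{2}{3}n^2 - \varepsilon n^2$. Then either $H \subseteq H^*$ (that is, $V(H)$ can be partitioned into sets $S$ and $T$ with $|S| = n/3+1$ and $|T| = 2n/3-1$ such that every edge of $H$ contains at least two vertices of $T$), or $H$ contains a perfect matching.
   Context: A $3$-uniform hypergraph $H=(V,E)$ has edges that are $3$-element subsets of $V$. The degree $\deg(v)$ of a vertex is the number of edges containing it; a vertex is isolated if its degree is $0$. Two distinct vertices $u,v$ are adjacent if some edge contains both. $\sigma_2'(H) = \min\{\deg(u)+\deg(v) : u,v \text{ adjacent in } H\}$. $H^*$ denotes the $3$-graph on $n$ vertices whose vertex set is partitioned into $S$ of size $n/3+1$ and $T$ of size $2n/3-1$, with edge set all triples containing at least two vertices of $T$. A perfect matching is a set of pairwise disjoint edges covering all vertices. *)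

theory Defs
  imports Complex_Main "HOL-Library.Disjoint_Sets"
begin

definition three_graph :: "'a set \<Rightarrow> 'a set set \<Rightarrow> bool" where
  "three_graph V E \<longleftrightarrow> finite V \<and> (\<forall>e\<in>E. e \<subseteq> V \<and> card e = 3)"

definition hdegree :: "'a set set \<Rightarrow> 'a \<Rightarrow> nat" where
  "hdegree E v = card {e \<in> E. v \<in> e}"

definition hadjacent :: "'a set set \<Rightarrow> 'a \<Rightarrow> 'a \<Rightarrow> bool" where
  "hadjacent E u v \<longleftrightarrow> u \<noteq> v \<and> (\<exists>e\<in>E. u \<in> e \<and> v \<in> e)"

text \<open>The minimum is over a nonempty set as soon as there is an edge, in particular for every
  3-graph with at least one vertex and without isolated vertices.\<close>

definition sigma2' :: "'a set set \<Rightarrow> nat" where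
  "sigma2' E = Min {hdegree E u + hdegree E v | u v. hadjacent E u v}"

text \<open>The edge set of \<open>H\<^sup>*\<close> for a given partition of the vertex set into \<open>S\<close> and \<open>T\<close>.\<close>

definition Hstar_edges :: "'a set \<Rightarrow> 'a set \<Rightarrow> 'a set set" where
  "Hstar_edges S T = {e. e \<subseteq> S \<union> T \<and> card e = 3 \<and> card (e \<inter> T) \<ge> 2}"

definition sub_Hstar :: "'a set \<Rightarrow> 'a set set \<Rightarrow> bool" where
  "sub_Hstar V E \<longleftrightarrow>
     (\<exists>S T. S \<union> T = V \<and> S \<inter> T = {} \<and>
            real (card S) = real (card V) / 3 + 1 \<and> real (card T) = 2 * real (card V) / 3 - 1 \<and>
            E \<subseteq> Hstar_edges S T)"

definition perfect_matching :: "'a set \<Rightarrow> 'a set set \<Rightarrow> 'a set set \<Rightarrow> bool" where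
  "perfect_matching V E M \<longleftrightarrow> M \<subseteq> E \<and> disjoint M \<and> \<Union>M = V"

end

theory Submission
  imports Defs
begin

text \<open>
  Degrees are measured by links of ordered pairs, so that a vertex has degree at most \<open>n\<^sup>2\<close> and
  the threshold for a vertex is \<open>2/3 n\<^sup>2\<close>. If a matching \<open>M\<close> of a hypergraph cannot be enlarged and
  \<open>x\<close>, \<open>y\<close>, \<open>z\<close> are uncovered, then for two matching edges \<open>a\<close>, \<open>b\<close> there are no three disjoint
  edges consisting of one of \<open>x\<close>, \<open>y\<close>, \<open>z\<close>, one vertex of \<open>a\<close> and one of \<open>b\<close>; averaging, the three
  links have at most 18 of the 27 pairs on \<open>a \<times> b\<close>. Hence the degree sum of \<open>x\<close>, \<open>y\<close>, \<open>z\<close> is at most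
  \<open>2 n\<^sup>2 + O(n)\<close>, so adjacent vertices of degree sum above \<open>4/3 n\<^sup>2\<close> are
  only an \<open>\<epsilon> n\<^sup>2\<close> away from a contradiction.

  With six uncovered vertices the extremal case is rigid: on almost all \<open>a \<times> b\<close> the links of four
  uncovered vertices coincide and miss exactly the pairs at one vertex of \<open>a\<close> or of \<open>b\<close>. Exchanging
  uncovered and covered vertices, almost all vertices have this link, which is contradictory. So all
  degrees above \<open>(2/3 - c) n\<^sup>2\<close> force a matching that misses three vertices, and a small
  family of absorbing gadgets, chosen greedily, takes these three in.

  In general let \<open>W\<close> be the set of vertices of degree below \<open>(2/3 - \<epsilon>) n\<^sup>2\<close>; no edge has two vertices
  in \<open>W\<close>, so the graph is contained in \<open>H\<^sup>*\<close> when \<open>|W| > n/3\<close>. A small \<open>W\<close> is covered greedily. If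
  \<open>W\<close> is neither small nor too big, pass to an edge-maximal counterexample among the hypergraphs
  whose edges meet \<open>W\<close> at most once. Every missing edge \<open>xyz\<close> is then the complement of a
  matching, so its degree sum is at most \<open>2 n\<^sup>2 + O(n)\<close>, and smaller by a positive proportion of \<open>n\<^sup>2\<close>
  if it meets \<open>W\<close>, since pairs of vertices in \<open>W\<close> lie in no link. This forces so many edges that a
  perfect matching is found directly or from the result for large minimum degree.
\<close>

section \<open>Links and matchings\<close>

text \<open>Ordered pairs count every edge at \<open>v\<close> twice, so degrees are compared with
  \<open>card V * card V\<close>, and each block \<open>a \<times> b\<close> of two matching edges
  becomes a 3 by 3 table of cells.\<close>

definition lk :: "'a set set \<Rightarrow> 'a \<Rightarrow> ('a \<times> 'a) set" where
  "lk E v = {(p, q). {v, p, q} \<in> E}"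

definition matching :: "'a set set \<Rightarrow> 'a set set \<Rightarrow> bool" where
  "matching E M \<longleftrightarrow> M \<subseteq> E \<and> disjoint M"

lemma lk_iff [simp]: "(p, q) \<in> lk E v \<longleftrightarrow> {v, p, q} \<in> E"
  by (simp add: lk_def)

lemma card3_iff: "card {x, y, z} = 3 \<longleftrightarrow> x \<noteq> y \<and> x \<noteq> z \<and> y \<noteq> z"
  by (auto simp: card_insert_if)

lemma three_graph_finite: "three_graph V E \<Longrightarrow> finite E"
  unfolding three_graph_def by (meson PowI finite_Pow_iff finite_subset subsetI)

lemma three_graph_edge:
  assumes "three_graph V E" "{x, y, z} \<in> E"
  shows "x \<noteq> y" "x \<noteq> z" "y \<noteq> z" "x \<in> V" "y \<in> V" "z \<in> V"
  using assms card3_iff[of x y z] unfolding three_graph_def by auto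

lemma lk_subset: "three_graph V E \<Longrightarrow> lk E v \<subseteq> V \<times> V"
  using three_graph_edge by (fastforce simp: lk_def)

lemma finite_lk: "three_graph V E \<Longrightarrow> finite (lk E v)"
  using lk_subset[of V E v] by (auto simp: three_graph_def intro: finite_subset)

lemma card_lk_le:
  assumes "three_graph V E"
  shows "card (lk E v) \<le> card V * card V"
proof -
  have "finite (V \<times> V)" using assms by (auto simp: three_graph_def)
  from card_mono[OF this lk_subset[OF assms]] show ?thesis by (simp add: card_cartesian_product)
qed

lemma lk_mono: "E \<subseteq> E' \<Longrightarrow> lk E v \<subseteq> lk E' v"
  by (auto simp: lk_def)

lemma card_lk:
  assumes "three_graph V E"
  shows "card (lk E v) = 2 * hdegree E v"
proof -
  let ?F = "{e \<in> E. v \<in> e}"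
  let ?P = "\<lambda>e. {(p, q). {v, p, q} = e}"
  have fin: "finite ?F" using three_graph_finite[OF assms] by simp
  have eq: "lk E v = (\<Union>e\<in>?F. ?P e)" by (auto simp: lk_def)
  have c2: "card (?P e) = 2 \<and> finite (?P e)" if "e \<in> ?F" for e
  proof -
    from that have "card e = 3" "v \<in> e" using assms by (auto simp: three_graph_def)
    then obtain p q where e: "e = {v, p, q}" "v \<noteq> p" "v \<noteq> q" "p \<noteq> q"
      by (smt (verit) card_3_iff insert_commute insert_iff singletonD)
    have "(x, y) = (p, q) \<or> (x, y) = (q, p)" if "{v, x, y} = {v, p, q}" for x y
    proof -
      have "card {v, x, y} = 3" using that e by (simp add: card3_iff)
      then have "v \<noteq> x" "v \<noteq> y" "x \<noteq> y" by (simp_all add: card3_iff)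
      moreover have "x \<in> {v, p, q}" "y \<in> {v, p, q}" using that by blast+
      ultimately show ?thesis by auto
    qed
    then have "?P e = {(p, q), (q, p)}" using e(1) by (auto simp: insert_commute)
    with e show ?thesis by simp
  qed
  have "card (lk E v) = (\<Sum>e\<in>?F. card (?P e))"
    unfolding eq by (rule card_UN_disjoint) (use fin c2 in auto)
  also have "\<dots> = (\<Sum>e\<in>?F. 2)" using c2 by simp
  finally show ?thesis by (simp add: hdegree_def)
qed

lemma matching_finite: "three_graph V E \<Longrightarrow> matching E M \<Longrightarrow> finite M"
  by (meson finite_subset matching_def three_graph_finite)

text \<open>The exchange step behind most later constructions: enlarging, swapping, absorbing and
  gluing of matchings are instances of it. Cardinalities add up because edges are nonempty.\<close>

lemma matching_replace:
  assumes tg: "three_graph V E" and M: "matching E M" and N: "N \<subseteq> M" and N': "matching E N'"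
    and dis: "\<Union>N' \<inter> \<Union>(M - N) = {}"
  shows "matching E (M - N \<union> N')" "card (M - N \<union> N') = card M - card N + card N'"
proof -
  have ne: "e \<noteq> {}" if "e \<in> E" for e using tg that by (auto simp: three_graph_def)
  have "disjoint (M - N)" using M by (meson Diff_subset matching_def pairwise_subset)
  then show "matching E (M - N \<union> N')"
    using M N' dis unfolding matching_def by (auto intro!: disjoint_union)
  have "(M - N) \<inter> N' = {}"
  proof -
    have False if "e \<in> M - N" "e \<in> N'" for e
      using that dis ne[of e] M unfolding matching_def by blast
    then show ?thesis by blast
  qed
  then show "card (M - N \<union> N') = card M - card N + card N'"
    using matching_finite[OF tg M] matching_finite[OF tg N'] N
    by (simp add: card_Un_disjoint card_Diff_subset finite_subset)
qed

lemma matching_card_Union: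
  assumes "three_graph V E" "matching E M"
  shows "card (\<Union>M) = 3 * card M" "\<Union>M \<subseteq> V" "finite (\<Union>M)"
proof -
  have "finite e" if "e \<in> M" for e
    using assms that by (auto simp: matching_def three_graph_def intro: finite_subset)
  then have "card (\<Union>M) = (\<Sum>e\<in>M. card e)"
    using assms by (intro card_Union_disjoint) (auto simp: matching_def)
  also have "\<dots> = (\<Sum>e\<in>M. 3)" using assms by (intro sum.cong) (auto simp: matching_def three_graph_def)
  finally show "card (\<Union>M) = 3 * card M" by simp
  show "\<Union>M \<subseteq> V" using assms by (auto simp: matching_def three_graph_def)
  then show "finite (\<Union>M)" using assms by (meson finite_subset three_graph_def)
qed

lemma perfect_matchingI:
  assumes "three_graph V E" "matching E M" "3 * card M = card V"
  shows "perfect_matching V E M"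
  using assms matching_card_Union[OF assms(1,2)]
  by (simp add: perfect_matching_def matching_def card_subset_eq three_graph_def)

lemma matching_insert3:
  assumes "{x, p, q} \<in> E" "{y, p', q'} \<in> E" "{z, p'', q''} \<in> E"
    "{x, p, q} \<inter> {y, p', q'} = {}" "{x, p, q} \<inter> {z, p'', q''} = {}" "{y, p', q'} \<inter> {z, p'', q''} = {}"
  shows "matching E {{x, p, q}, {y, p', q'}, {z, p'', q''}}"
    "card {{x, p, q}, {y, p', q'}, {z, p'', q''}} = 3"
  using assms by (auto simp: matching_def pairwise_insert disjnt_def card3_iff)

text \<open>The three edges would use exactly the six vertices of two matching edges and three
  uncovered vertices, so two edges could be traded for three.\<close>

lemma no_rainbow:
  assumes tg: "three_graph V E" and M: "matching E M"
    and mx: "\<And>M'. matching E M' \<Longrightarrow> card M' \<noteq> Suc (card M)"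
    and ab: "{a0, a1, a2} \<in> M" "{b0, b1, b2} \<in> M" "{a0, a1, a2} \<noteq> {b0, b1, b2}"
    and xyz: "distinct [x, y, z]" "x \<notin> \<Union>M" "y \<notin> \<Union>M" "z \<notin> \<Union>M"
  shows "\<not> ({x, a0, b0} \<in> E \<and> {y, a1, b1} \<in> E \<and> {z, a2, b2} \<in> E)"
proof
  assume E: "{x, a0, b0} \<in> E \<and> {y, a1, b1} \<in> E \<and> {z, a2, b2} \<in> E"
  let ?a = "{a0, a1, a2}" and ?b = "{b0, b1, b2}"
  let ?N = "{{x, a0, b0}, {y, a1, b1}, {z, a2, b2}}"
  have dab: "?a \<inter> ?b = {}" using M ab unfolding matching_def by (meson disjointD)
  have "?a \<in> E" "?b \<in> E" using ab M by (auto simp: matching_def)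
  note da = three_graph_edge(1-3)[OF tg this(1)] three_graph_edge(1-3)[OF tg this(2)]
  have out: "x \<notin> ?a" "x \<notin> ?b" "y \<notin> ?a" "y \<notin> ?b" "z \<notin> ?a" "z \<notin> ?b"
    using ab xyz by blast+
  have N: "matching E ?N" "card ?N = 3"
    by (rule matching_insert3; use E da dab xyz(1) out in auto)+
  have "\<Union>?N \<inter> \<Union>(M - {?a, ?b}) = {}"
  proof -
    have "c \<inter> ?a = {} \<and> c \<inter> ?b = {}" if "c \<in> M - {?a, ?b}" for c
      using M ab that unfolding matching_def by (metis DiffD1 DiffD2 disjointD insertI1 insert_iff)
    then show ?thesis using xyz by fastforce
  qed
  then have "matching E (M - {?a, ?b} \<union> ?N)" "card (M - {?a, ?b} \<union> ?N) = card M - card {?a, ?b} + card ?N"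
    using matching_replace[OF tg M _ N(1), of "{?a, ?b}"] ab by auto
  moreover have "card {?a, ?b} = 2" using ab by simp
  moreover have "card M \<ge> 2"
    using card_mono[of M "{?a, ?b}"] matching_finite[OF tg M] ab by simp
  ultimately show False using mx N(2) by fastforce
qed

lemma card_lk_block:
  assumes "a = {a0, a1, a2}" "b = {b0, b1, b2}" "distinct [a0, a1, a2]" "distinct [b0, b1, b2]"
  shows "card (lk E v \<inter> a \<times> b) = (\<Sum>p\<in>a. \<Sum>q\<in>b. of_bool ({v, p, q} \<in> E))"
proof -
  have fin: "finite (a \<times> b)" using assms by auto
  have "card (lk E v \<inter> a \<times> b) = (\<Sum>x\<in>a \<times> b. of_bool (x \<in> lk E v))"
    using fin by (simp add: sum.If_cases Int_commute of_bool_def)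
  also have "\<dots> = (\<Sum>p\<in>a. \<Sum>q\<in>b. of_bool ({v, p, q} \<in> E))"
    by (simp add: sum.cartesian_product case_prod_beta' lk_def)
  finally show ?thesis .
qed

section \<open>Matchings that cannot be enlarged\<close>

abbreviation blk :: "'a set set \<Rightarrow> 'a \<Rightarrow> 'a set \<Rightarrow> 'a set \<Rightarrow> nat" where
  "blk E v a b \<equiv> card (lk E v \<inter> a \<times> b)"

text \<open>The extremal pattern: for \<open>r \<in> a\<close>, the link of \<open>v\<close> misses
  exactly one line of the table on \<open>a \<times> b\<close>. It keeps six of nine cells, which
  matches the density 2/3.\<close>

definition row :: "'a set set \<Rightarrow> 'a \<Rightarrow> 'a \<Rightarrow> 'a set \<Rightarrow> 'a set \<Rightarrow> bool" where
  "row E v r a b \<longleftrightarrow> (\<forall>p\<in>a. \<forall>q\<in>b. {v, p, q} \<in> E \<longleftrightarrow> p \<noteq> r)"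

lemma of_bool3_le: "\<not> (P \<and> Q \<and> R) \<Longrightarrow> of_bool P + of_bool Q + of_bool R \<le> (2::nat)"
  by auto

lemma of_bool3_eq_2: "of_bool P + of_bool Q + of_bool R = (2::nat) \<longleftrightarrow>
    P \<and> Q \<and> \<not> R \<or> P \<and> \<not> Q \<and> R \<or> \<not> P \<and> Q \<and> R"
  by (cases P; cases Q; cases R; simp)

lemma three_graph_triple:
  assumes "three_graph V E" "a \<in> E"
  obtains p q r where "a = {p, q, r}" "distinct [p, q, r]"
proof -
  have "card a = 3" using assms by (auto simp: three_graph_def)
  then show ?thesis using that by (auto simp: card_3_iff)
qed

lemma triple_with:
  assumes "card a = 3" "p \<in> a"
  obtains q r where "{p, q, r} = a" "distinct [p, q, r]"
proof -
  have "card (a - {p}) = 2" using assms by simp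
  then obtain q r where "a - {p} = {q, r}" "q \<noteq> r" by (meson card_2_iff)
  then show ?thesis using that[of q r] assms(2) by auto
qed

text \<open>A 3 by 3 table has six transversals and each cell lies on two of them, so one zero per
  transversal means three zeros. Two zeros in different rows and columns would share a transversal,
  so the zeros fill a row or a column.\<close>

lemma one_zero_per_transversal:
  assumes "distinct [a0, a1, a2]" "distinct [b0, b1, b2]"
    and "of_bool (f a0 b0) + of_bool (f a1 b1) + of_bool (f a2 b2) = (2::nat)"
      "of_bool (f a0 b1) + of_bool (f a1 b2) + of_bool (f a2 b0) = (2::nat)"
      "of_bool (f a0 b2) + of_bool (f a1 b0) + of_bool (f a2 b1) = (2::nat)"
      "of_bool (f a0 b0) + of_bool (f a1 b2) + of_bool (f a2 b1) = (2::nat)"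
      "of_bool (f a0 b1) + of_bool (f a1 b0) + of_bool (f a2 b2) = (2::nat)"
      "of_bool (f a0 b2) + of_bool (f a1 b1) + of_bool (f a2 b0) = (2::nat)"
  shows "(\<exists>r\<in>{a0, a1, a2}. \<forall>p\<in>{a0, a1, a2}. \<forall>q\<in>{b0, b1, b2}. f p q \<longleftrightarrow> p \<noteq> r) \<or>
    (\<exists>r\<in>{b0, b1, b2}. \<forall>p\<in>{b0, b1, b2}. \<forall>q\<in>{a0, a1, a2}. f q p \<longleftrightarrow> p \<noteq> r)"
  using assms
  by (simp add: of_bool3_eq_2 eq_commute[of a1 a0] eq_commute[of a2 a0] eq_commute[of a2 a1]
      eq_commute[of b1 b0] eq_commute[of b2 b0] eq_commute[of b2 b1]) argo

text \<open>Since subsets of matchings are matchings, excluding the size \<open>Suc (card M)\<close>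
  already makes \<open>M\<close> maximum. Edge-maximal counterexamples supply maximality in this
  form.\<close>

locale stuck_matching =
  fixes V :: "'a set" and E M
  assumes tg: "three_graph V E" and M: "matching E M"
    and mx: "\<And>M'. matching E M' \<Longrightarrow> card M' \<noteq> Suc (card M)"
begin

lemma edge_triple:
  assumes "a \<in> M"
  obtains p q r where "a = {p, q, r}" "distinct [p, q, r]"
  using assms M three_graph_triple[OF tg] unfolding matching_def by blast

lemma edge_card: "a \<in> M \<Longrightarrow> card a = 3"
  using M tg by (auto simp: matching_def three_graph_def)

text \<open>Nine rainbow transversals partition the 27 cells, and each has at most two edges. In the
  case of equality each has exactly two; stating this for one labelling is enough, because
  relabelling the two matching edges reaches every other transversal.\<close>

lemma block_sum:
  assumes ab: "{a0, a1, a2} \<in> M" "{b0, b1, b2} \<in> M" "{a0, a1, a2} \<noteq> {b0, b1, b2}"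
    and xyz: "distinct [x, y, z]" "x \<notin> \<Union>M" "y \<notin> \<Union>M" "z \<notin> \<Union>M"
  shows "blk E x {a0, a1, a2} {b0, b1, b2} + blk E y {a0, a1, a2} {b0, b1, b2}
     + blk E z {a0, a1, a2} {b0, b1, b2} \<le> 18" (is "?L \<le> 18")
    and "blk E x {a0, a1, a2} {b0, b1, b2} + blk E y {a0, a1, a2} {b0, b1, b2}
     + blk E z {a0, a1, a2} {b0, b1, b2} = 18 \<Longrightarrow>
     of_bool ({x, a0, b0} \<in> E) + of_bool ({y, a1, b1} \<in> E) + of_bool ({z, a2, b2} \<in> E) = (2::nat)"
proof -
  have "{a0, a1, a2} \<in> E" "{b0, b1, b2} \<in> E" using ab M by (auto simp: matching_def)
  note d = three_graph_edge(1-3)[OF tg this(1)] three_graph_edge(1-3)[OF tg this(2)]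
  define f where "f v p q = int (of_bool ({v, p, q} \<in> E))" for v p q
  have blk: "int (blk E v {a0, a1, a2} {b0, b1, b2}) =
      f v a0 b0 + f v a0 b1 + f v a0 b2 + f v a1 b0 + f v a1 b1 + f v a1 b2
      + f v a2 b0 + f v a2 b1 + f v a2 b2" for v
    using d by (subst card_lk_block[OF refl refl]) (simp_all add: f_def)
  have R: "f x p0 q0 + f y p1 q1 + f z p2 q2 \<le> 2"
    if "{p0, p1, p2} = {a0, a1, a2}" "{q0, q1, q2} = {b0, b1, b2}" for p0 p1 p2 q0 q1 q2
  proof -
    have "\<not> ({x, p0, q0} \<in> E \<and> {y, p1, q1} \<in> E \<and> {z, p2, q2} \<in> E)"
      by (rule no_rainbow[OF tg M mx _ _ _ xyz]) (use that ab in simp_all)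
    from of_bool3_le[OF this] show ?thesis unfolding f_def by linarith
  qed
  \<comment> \<open>The nine translates of a transversal by \<open>\<int>\<^sub>3 \<times> \<int>\<^sub>3\<close> use each of the 27 cells once.\<close>
  have r: "{a0, a1, a2} = {a0, a1, a2}" "{a1, a2, a0} = {a0, a1, a2}" "{a2, a0, a1} = {a0, a1, a2}"
     "{b0, b1, b2} = {b0, b1, b2}" "{b1, b2, b0} = {b0, b1, b2}" "{b2, b0, b1} = {b0, b1, b2}" by auto
  note R9 = R[OF r(1) r(4)] R[OF r(1) r(5)] R[OF r(1) r(6)]
    R[OF r(2) r(4)] R[OF r(2) r(5)] R[OF r(2) r(6)] R[OF r(3) r(4)] R[OF r(3) r(5)] R[OF r(3) r(6)]
  have L: "int ?L = int (blk E x {a0, a1, a2} {b0, b1, b2}) + int (blk E y {a0, a1, a2} {b0, b1, b2})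
     + int (blk E z {a0, a1, a2} {b0, b1, b2})" by simp
  have "int ?L \<le> 18" unfolding L blk using R9 by linarith
  then show "?L \<le> 18" by linarith
  assume "?L = 18"
  then have "int ?L = 18" by simp
  then have "2 \<le> f x a0 b0 + f y a1 b1 + f z a2 b2" unfolding L blk using R9 by linarith
  with R9(1) show "of_bool ({x, a0, b0} \<in> E) + of_bool ({y, a1, b1} \<in> E) + of_bool ({z, a2, b2} \<in> E) = (2::nat)"
    unfolding f_def by linarith
qed

lemma block_sum_le:
  assumes ab: "a \<in> M" "b \<in> M" "a \<noteq> b"
    and xyz: "distinct [x, y, z]" "x \<notin> \<Union>M" "y \<notin> \<Union>M" "z \<notin> \<Union>M"
  shows "blk E x a b + blk E y a b + blk E z a b \<le> 18"
proof -
  obtain a0 a1 a2 where "a = {a0, a1, a2}" by (rule edge_triple[OF ab(1)])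
  moreover obtain b0 b1 b2 where "b = {b0, b1, b2}" by (rule edge_triple[OF ab(2)])
  ultimately show ?thesis using block_sum(1)[of a0 a1 a2 b0 b1 b2] assms by simp
qed

text \<open>Cells that put two vertices of \<open>W\<close> into one triple are empty. With sum 18
  every transversal would have just one empty cell, and the forced empty cells leave a transversal
  consisting of three edges.\<close>

lemma block_sum_le17:
  assumes ab: "a \<in> M" "b \<in> M" "a \<noteq> b"
    and xyz: "distinct [x, y, z]" "x \<notin> \<Union>M" "y \<notin> \<Union>M" "z \<notin> \<Union>M"
    and W: "x \<in> W" "a \<inter> W \<noteq> {}" "b \<inter> W \<noteq> {}" "\<And>e. e \<in> E \<Longrightarrow> card (e \<inter> W) \<le> 1"
  shows "blk E x a b + blk E y a b + blk E z a b \<le> 17"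
proof (rule ccontr)
  assume "\<not> ?thesis"
  then have eq: "blk E x a b + blk E y a b + blk E z a b = 18"
    using block_sum_le[OF ab xyz] by linarith
  obtain w where w: "w \<in> a" "w \<in> W" using W by blast
  obtain w' where w': "w' \<in> b" "w' \<in> W" using W by blast
  obtain a1 a2 where a: "a = {w, a1, a2}" using triple_with[OF edge_card[OF ab(1)] w(1)] by metis
  obtain b1 b2 where b: "b = {w', b1, b2}" using triple_with[OF edge_card[OF ab(2)] w'(1)] by metis
  have two: "u = u'" if "e \<in> E" "u \<in> e" "u \<in> W" "u' \<in> e" "u' \<in> W" for e u u'
  proof (rule ccontr)
    assume "u \<noteq> u'"
    moreover have "finite (e \<inter> W)" using tg that by (auto simp: three_graph_def intro: finite_subset)
    ultimately have "card {u, u'} \<le> card (e \<inter> W)" using that by (intro card_mono) auto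
    then show False using W(4)[OF that(1)] \<open>u \<noteq> u'\<close> by simp
  qed
  have wx: "w \<noteq> x" "w' \<noteq> x" using xyz ab w w' by auto
  have "a \<inter> b = {}" using ab M unfolding matching_def by (meson disjointD)
  then have "w \<noteq> w'" using w w' by auto
  with wx have f: "{x, w, q} \<notin> E" "{x, p, w'} \<notin> E" "{y, w, w'} \<notin> E" "{z, w, w'} \<notin> E" for p q
    using two[of "{x, w, q}" w x] two[of "{x, p, w'}" w' x] two[of "{y, w, w'}" w w']
      two[of "{z, w, w'}" w w'] W(1) w(2) w'(2) by auto
  have C: "of_bool ({x, p0, q0} \<in> E) + of_bool ({y, p1, q1} \<in> E) + of_bool ({z, p2, q2} \<in> E) = (2::nat)"
    if "{p0, p1, p2} = a" "{q0, q1, q2} = b" for p0 p1 p2 q0 q1 q2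
    using block_sum(2)[of p0 p1 p2 q0 q1 q2 x y z] that ab xyz eq by simp
  have s: "{a1, w, a2} = a" "{a1, a2, w} = a" "{a2, w, a1} = a" "{w, a1, a2} = a" "{w, a2, a1} = a"
    "{b1, w', b2} = b" "{b1, b2, w'} = b" "{b2, w', b1} = b" "{w', b1, b2} = b" "{w', b2, b1} = b"
    "{b2, b1, w'} = b" using a b by auto
  \<comment> \<open>In each of these transversals the single empty cell is one containing two
    vertices of \<open>W\<close>, so the cell named here is an edge. The three edges form a
    transversal themselves.\<close>
  have "{x, a1, b2} \<in> E" using C[OF s(1) s(8)] f(3) unfolding of_bool3_eq_2 by blast
  moreover have "{y, w, b1} \<in> E" using C[OF s(1) s(9)] f(2)[of a1] unfolding of_bool3_eq_2 by blast
  moreover have "{z, a2, w'} \<in> E" using C[OF s(4) s(7)] f(1)[of b1] unfolding of_bool3_eq_2 by blast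
  ultimately show False using C[OF s(1) s(11)] by simp
qed

text \<open>The vertex \<open>r\<close> is chosen before \<open>v\<close>: all of \<open>Q\<close>
  misses the same line, so the pattern of one vertex determines that of the others.\<close>

definition tight :: "'a set \<Rightarrow> 'a set \<Rightarrow> 'a set \<Rightarrow> bool" where
  "tight Q a b \<longleftrightarrow> (\<exists>r\<in>a. \<forall>v\<in>Q. row E v r a b) \<or> (\<exists>r\<in>b. \<forall>v\<in>Q. row E v r b a)"

text \<open>Adding the bound 18 over the four triples counts each vertex three times, which gives
  24. Equality makes every triple extremal; comparing triples that differ in one vertex shows that
  the four links agree on the block, and the common link has one zero on each transversal.\<close>

lemma block_sum4:
  assumes ab: "a \<in> M" "b \<in> M" "a \<noteq> b"
    and Q: "distinct [x, y, z, t]" "x \<notin> \<Union>M" "y \<notin> \<Union>M" "z \<notin> \<Union>M" "t \<notin> \<Union>M"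
  shows "blk E x a b + blk E y a b + blk E z a b + blk E t a b \<le> 24"
    and "blk E x a b + blk E y a b + blk E z a b + blk E t a b = 24 \<Longrightarrow> tight {x, y, z, t} a b"
proof -
  have "blk E x a b + blk E y a b + blk E z a b \<le> 18" "blk E x a b + blk E y a b + blk E t a b \<le> 18"
     "blk E x a b + blk E z a b + blk E t a b \<le> 18" "blk E y a b + blk E z a b + blk E t a b \<le> 18"
    using block_sum_le[OF ab] Q by simp_all
  note le = this
  show "blk E x a b + blk E y a b + blk E z a b + blk E t a b \<le> 24" using le by linarith
  assume eq24: "blk E x a b + blk E y a b + blk E z a b + blk E t a b = 24"
  have eq: "blk E x a b + blk E y a b + blk E z a b = 18" "blk E x a b + blk E y a b + blk E t a b = 18"
     "blk E x a b + blk E z a b + blk E t a b = 18" "blk E y a b + blk E z a b + blk E t a b = 18"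
    using le eq24 by linarith+
  have C: "of_bool ({v, p0, q0} \<in> E) + of_bool ({v', p1, q1} \<in> E) + of_bool ({v'', p2, q2} \<in> E) = (2::nat)"
    if "{p0, p1, p2} = a" "{q0, q1, q2} = b" "distinct [v, v', v'']" "v \<notin> \<Union>M" "v' \<notin> \<Union>M" "v'' \<notin> \<Union>M"
       "blk E v a b + blk E v' a b + blk E v'' a b = 18" for p0 p1 p2 q0 q1 q2 v v' v''
    using block_sum(2)[of p0 p1 p2 q0 q1 q2 v v' v''] that ab by simp
  obtain a0 a1 a2 where a: "a = {a0, a1, a2}" "distinct [a0, a1, a2]" by (rule edge_triple[OF ab(1)])
  obtain b0 b1 b2 where b: "b = {b0, b1, b2}" "distinct [b0, b1, b2]" by (rule edge_triple[OF ab(2)])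
  \<comment> \<open>Complete the cell to a transversal and keep \<open>v'\<close>,
    \<open>v''\<close> on the other two cells. The counts with \<open>v\<close> and with
    \<open>t\<close> are both 2, so the two entries agree.\<close>
  have same: "({v, p0, q0} \<in> E) = ({t, p0, q0} \<in> E)" if h: "p0 \<in> a" "q0 \<in> b" "v \<in> {x, y, z}" for p0 q0 v
  proof -
    obtain p1 p2 where p: "{p0, p1, p2} = a" using triple_with[OF edge_card[OF ab(1)] h(1)] by metis
    obtain q1 q2 where q: "{q0, q1, q2} = b" using triple_with[OF edge_card[OF ab(2)] h(2)] by metis
    have "card {x, y, z} = 3" using Q by simp
    from triple_with[OF this h(3)] obtain v' v''
      where v: "distinct [v, v', v'']" "{v, v', v''} = {x, y, z}" by metis
    have v3: "v \<in> {x, y, z}" "v' \<in> {x, y, z}" "v'' \<in> {x, y, z}" using v(2) by blast+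
    then have o: "v \<notin> \<Union>M" "v' \<notin> \<Union>M" "v'' \<notin> \<Union>M" using Q(2-4) by fast+
    have tv: "t \<noteq> v'" "t \<noteq> v''" using v3 Q(1) by auto
    have s: "blk E v a b + blk E v' a b + blk E v'' a b = 18" "blk E t a b + blk E v' a b + blk E v'' a b = 18"
    proof -
      have "(\<Sum>u\<in>{v, v', v''}. blk E u a b) = (\<Sum>u\<in>{x, y, z}. blk E u a b)" using v(2) by simp
      then show "blk E v a b + blk E v' a b + blk E v'' a b = 18" using v(1) Q(1) eq by simp
      moreover have "v = x \<or> v = y \<or> v = z" using that by auto
      ultimately show "blk E t a b + blk E v' a b + blk E v'' a b = 18" using eq eq24 by auto
    qed
    show ?thesis
      using C[OF p q v(1) o s(1)] C[OF p q _ Q(5) o(2,3) s(2)] tv v(1) unfolding of_bool3_eq_2 by auto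
  qed
  \<comment> \<open>As the links agree on the block, the rainbow condition becomes a condition on
    the link of \<open>t\<close> alone.\<close>
  have D: "of_bool ({t, p0, q0} \<in> E) + of_bool ({t, p1, q1} \<in> E) + of_bool ({t, p2, q2} \<in> E) = (2::nat)"
    if "{p0, p1, p2} = a" "{q0, q1, q2} = b" for p0 p1 p2 q0 q1 q2
  proof -
    have "p0 \<in> a" "p1 \<in> a" "p2 \<in> a" "q0 \<in> b" "q1 \<in> b" "q2 \<in> b" using that by blast+
    then have "({x, p0, q0} \<in> E) = ({t, p0, q0} \<in> E)" "({y, p1, q1} \<in> E) = ({t, p1, q1} \<in> E)"
      "({z, p2, q2} \<in> E) = ({t, p2, q2} \<in> E)" using same by simp_all
    with C[OF that _ Q(2,3,4) eq(1)] Q(1) show ?thesis by simp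
  qed
  have pb: "{b0, b1, b2} = b" "{b0, b2, b1} = b" "{b1, b0, b2} = b" "{b1, b2, b0} = b" "{b2, b0, b1} = b" "{b2, b1, b0} = b"
    using b(1) by auto
  note D' = D[OF a(1)[symmetric]]
  have pat: "(\<exists>r\<in>a. \<forall>p\<in>a. \<forall>q\<in>b. {t, p, q} \<in> E \<longleftrightarrow> p \<noteq> r) \<or>
    (\<exists>r\<in>b. \<forall>p\<in>b. \<forall>q\<in>a. {t, q, p} \<in> E \<longleftrightarrow> p \<noteq> r)"
    unfolding a(1) b(1)
    by (rule one_zero_per_transversal[OF a(2) b(2), of "\<lambda>p q. {t, p, q} \<in> E",
          OF D'[OF pb(1)] D'[OF pb(4)] D'[OF pb(5)] D'[OF pb(2)] D'[OF pb(3)] D'[OF pb(6)]])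
  have ra: "row E v r a b" if "\<forall>p\<in>a. \<forall>q\<in>b. {t, p, q} \<in> E \<longleftrightarrow> p \<noteq> r" "v \<in> {x, y, z, t}" for v r
    unfolding row_def
  proof (intro ballI)
    fix p q assume pq: "p \<in> a" "q \<in> b"
    have "({v, p, q} \<in> E) = ({t, p, q} \<in> E)" using same[OF pq, of v] that(2) by fast
    then show "({v, p, q} \<in> E) = (p \<noteq> r)" using that(1) pq by blast
  qed
  have rb: "row E v r b a" if "\<forall>p\<in>b. \<forall>q\<in>a. {t, q, p} \<in> E \<longleftrightarrow> p \<noteq> r" "v \<in> {x, y, z, t}" for v r
    unfolding row_def
  proof (intro ballI)
    fix p q assume pq: "p \<in> b" "q \<in> a"
    have "({v, q, p} \<in> E) = ({t, q, p} \<in> E)" using same[OF pq(2,1), of v] that(2) by fast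
    then have "({v, q, p} \<in> E) = (p \<noteq> r)" using that(1) pq by blast
    then show "({v, p, q} \<in> E) = (p \<noteq> r)" unfolding insert_commute[of q p] .
  qed
  from pat show "tight {x, y, z, t} a b" unfolding tight_def
  proof (elim disjE bexE)
    fix r assume "r \<in> a" "\<forall>p\<in>a. \<forall>q\<in>b. {t, p, q} \<in> E \<longleftrightarrow> p \<noteq> r"
    then show "(\<exists>r\<in>a. \<forall>v\<in>{x, y, z, t}. row E v r a b) \<or> (\<exists>r\<in>b. \<forall>v\<in>{x, y, z, t}. row E v r b a)"
      using ra by blast
  next
    fix r assume "r \<in> b" "\<forall>p\<in>b. \<forall>q\<in>a. {t, q, p} \<in> E \<longleftrightarrow> p \<noteq> r"
    then show "(\<exists>r\<in>a. \<forall>v\<in>{x, y, z, t}. row E v r a b) \<or> (\<exists>r\<in>b. \<forall>v\<in>{x, y, z, t}. row E v r b a)"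
      using rb by blast
  qed
qed

end

section \<open>Summing block counts over pairs of matching edges\<close>

lemma sum_pairs_le:
  fixes S :: "'b \<times> 'b \<Rightarrow> nat"
  assumes fin: "finite M" and P: "P \<subseteq> M \<times> M"
    and off: "\<And>a b. a \<in> M \<Longrightarrow> b \<in> M \<Longrightarrow> a \<noteq> b \<Longrightarrow> S (a, b) + of_bool ((a, b) \<in> P) \<le> c"
    and diag: "\<And>a. a \<in> M \<Longrightarrow> S (a, a) + of_bool ((a, a) \<in> P) \<le> c + d"
  shows "sum S (M \<times> M) + card P \<le> c * card M * card M + d * card M"
proof -
  \<comment> \<open>\<open>P\<close> collects pairs whose bound improves by one. The diagonal, where
    no exchange argument is available, only costs the linear term \<open>d * card M\<close>.\<close>
  have "card P = (\<Sum>x\<in>M \<times> M. of_bool (x \<in> P))"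
    using fin P by (simp add: sum.If_cases of_bool_def Int_absorb1)
  then have "sum S (M \<times> M) + card P = (\<Sum>x\<in>M \<times> M. S x + of_bool (x \<in> P))"
    by (simp add: sum.distrib)
  also have "\<dots> \<le> (\<Sum>x\<in>M \<times> M. c + d * of_bool (fst x = snd x))"
  proof (rule sum_mono)
    fix x assume "x \<in> M \<times> M"
    then show "S x + of_bool (x \<in> P) \<le> c + d * of_bool (fst x = snd x)"
      using off[of "fst x" "snd x"] diag[of "fst x"] by (cases x; cases "fst x = snd x") auto
  qed
  also have "\<dots> = c * card M * card M + d * (\<Sum>x\<in>M \<times> M. of_bool (fst x = snd x))"
    by (simp add: sum.distrib card_cartesian_product sum_distrib_left)
  also have "(\<Sum>x\<in>M \<times> M. of_bool (fst x = snd x)) = (\<Sum>a\<in>M. \<Sum>b\<in>M. of_bool (a = b) :: nat)"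
    by (simp add: sum.cartesian_product case_prod_beta')
  also have "\<dots> = (\<Sum>a\<in>M. 1)"
    using fin by (intro sum.cong refl) (simp add: of_bool_def)
  finally show ?thesis by simp
qed

context stuck_matching
begin

lemma finM: "finite M" using matching_finite[OF tg M] .

lemma finV: "finite V" using tg by (simp add: three_graph_def)

lemma blk_le_9: "a \<in> M \<Longrightarrow> b \<in> M \<Longrightarrow> blk E v a b \<le> 9"
proof -
  assume ab: "a \<in> M" "b \<in> M"
  have "finite a" "finite b" using edge_card[OF ab(1)] edge_card[OF ab(2)] by (auto intro: card_ge_0_finite)
  then have "blk E v a b \<le> card (a \<times> b)" by (intro card_mono) auto
  then show ?thesis using edge_card[OF ab(1)] edge_card[OF ab(2)] by (simp add: card_cartesian_product)
qed

lemma card_lk_le_blocks: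
  "card (lk E v) \<le> (\<Sum>x\<in>M \<times> M. blk E v (fst x) (snd x)) + 2 * card (V - \<Union>M) * card V"
proof -
  let ?L = "V - \<Union>M"
  have "lk E v \<subseteq> (\<Union>x\<in>M \<times> M. lk E v \<inter> fst x \<times> snd x) \<union> (?L \<times> V \<union> V \<times> ?L)"
  proof
    fix x assume x: "x \<in> lk E v"
    then have V: "fst x \<in> V" "snd x \<in> V" using lk_subset[OF tg, of v] by auto
    show "x \<in> (\<Union>x\<in>M \<times> M. lk E v \<inter> fst x \<times> snd x) \<union> (?L \<times> V \<union> V \<times> ?L)"
    proof (cases "fst x \<in> \<Union>M \<and> snd x \<in> \<Union>M")
      case True
      then obtain a b where "a \<in> M" "b \<in> M" "fst x \<in> a" "snd x \<in> b" by blast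
      then have "(a, b) \<in> M \<times> M" "x \<in> lk E v \<inter> fst (a, b) \<times> snd (a, b)" using x by (auto simp: mem_Times_iff)
      then show ?thesis by blast
    next
      case False
      then show ?thesis using V by (auto simp: mem_Times_iff)
    qed
  qed
  then have "card (lk E v) \<le> card ((\<Union>x\<in>M \<times> M. lk E v \<inter> fst x \<times> snd x) \<union> (?L \<times> V \<union> V \<times> ?L))"
    using finM finV finite_lk[OF tg] by (intro card_mono) auto
  also have "\<dots> \<le> card (\<Union>x\<in>M \<times> M. lk E v \<inter> fst x \<times> snd x) + (card (?L \<times> V) + card (V \<times> ?L))"
    by (rule order_trans[OF card_Un_le add_left_mono[OF card_Un_le]])
  also have "card (\<Union>x\<in>M \<times> M. lk E v \<inter> fst x \<times> snd x) \<le> (\<Sum>x\<in>M \<times> M. blk E v (fst x) (snd x))"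
    using finM by (intro card_UN_le) auto
  finally show ?thesis by (simp add: card_cartesian_product algebra_simps)
qed

text \<open>The main term is at most twice the square of \<open>card V\<close>, because
  \<open>M\<close> covers \<open>3 * card M\<close> vertices. The term \<open>9 * card M\<close>
  pays for diagonal blocks, where only the trivial bound 27 holds in place of 18.\<close>

lemma degree_sum3:
  assumes xyz: "distinct [x, y, z]" "x \<notin> \<Union>M" "y \<notin> \<Union>M" "z \<notin> \<Union>M"
    and P: "P \<subseteq> M \<times> M" "\<And>a b. (a, b) \<in> P \<Longrightarrow> a \<noteq> b \<and> blk E x a b + blk E y a b + blk E z a b \<le> 17"
  shows "card (lk E x) + card (lk E y) + card (lk E z) + card P
    \<le> 18 * card M * card M + 9 * card M + 6 * card (V - \<Union>M) * card V"
proof -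
  let ?S = "\<lambda>x'. blk E x (fst x') (snd x') + blk E y (fst x') (snd x') + blk E z (fst x') (snd x')"
  have "sum ?S (M \<times> M) + card P \<le> 18 * card M * card M + 9 * card M"
  proof (rule sum_pairs_le[OF finM P(1)])
    fix a b assume "a \<in> M" "b \<in> M" "a \<noteq> b"
    then show "?S (a, b) + of_bool ((a, b) \<in> P) \<le> 18"
      using block_sum_le[of a b x y z] xyz P(2)[of a b] by (cases "(a, b) \<in> P") auto
  next
    fix a assume a: "a \<in> M"
    then have "(a, a) \<notin> P" using P(2) by blast
    then show "?S (a, a) + of_bool ((a, a) \<in> P) \<le> 18 + 9"
      using blk_le_9[OF a a, of x] blk_le_9[OF a a, of y] blk_le_9[OF a a, of z] by simp
  qed
  then show ?thesis
    using card_lk_le_blocks[of x] card_lk_le_blocks[of y] card_lk_le_blocks[of z]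
    unfolding sum.distrib by linarith
qed

definition nontight :: "'a set \<Rightarrow> ('a set \<times> 'a set) set" where
  "nontight Q = {(a, b). a \<in> M \<and> b \<in> M \<and> a \<noteq> b \<and> \<not> tight Q a b}"

lemma nontight_subset: "nontight Q \<subseteq> M \<times> M" by (auto simp: nontight_def)

lemma finite_nontight: "finite (nontight Q)"
  by (rule finite_subset[OF nontight_subset finite_cartesian_product[OF finM finM]])

lemma degree_sum4:
  assumes Q: "distinct [x, y, z, t]" "x \<notin> \<Union>M" "y \<notin> \<Union>M" "z \<notin> \<Union>M" "t \<notin> \<Union>M"
  shows "card (lk E x) + card (lk E y) + card (lk E z) + card (lk E t) + card (nontight {x, y, z, t})
    \<le> 24 * card M * card M + 12 * card M + 8 * card (V - \<Union>M) * card V"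
proof -
  let ?S = "\<lambda>x'. blk E x (fst x') (snd x') + blk E y (fst x') (snd x') + blk E z (fst x') (snd x')
     + blk E t (fst x') (snd x')"
  let ?P = "nontight {x, y, z, t}"
  have "sum ?S (M \<times> M) + card ?P \<le> 24 * card M * card M + 12 * card M"
  proof (rule sum_pairs_le[OF finM nontight_subset])
    fix a b assume ab: "a \<in> M" "b \<in> M" "a \<noteq> b"
    from block_sum4[OF this Q] have le: "?S (a, b) \<le> 24" and eq: "?S (a, b) = 24 \<Longrightarrow> tight {x, y, z, t} a b"
      by simp_all
    show "?S (a, b) + of_bool ((a, b) \<in> ?P) \<le> 24"
    proof (cases "(a, b) \<in> ?P")
      case True
      then have "?S (a, b) \<noteq> 24" using eq by (auto simp: nontight_def)
      with True le show ?thesis by simp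
    qed (use le in simp)
  next
    fix a assume a: "a \<in> M"
    have "(a, a) \<notin> ?P" by (simp add: nontight_def)
    then show "?S (a, a) + of_bool ((a, a) \<in> ?P) \<le> 24 + 12"
      using blk_le_9[OF a a, of x] blk_le_9[OF a a, of y] blk_le_9[OF a a, of z] blk_le_9[OF a a, of t] by simp
  qed
  then show ?thesis
    using card_lk_le_blocks[of x] card_lk_le_blocks[of y] card_lk_le_blocks[of z] card_lk_le_blocks[of t]
    unfolding sum.distrib by linarith
qed

end

section \<open>Rigidity when six vertices are uncovered\<close>

locale near_perfect = stuck_matching +
  assumes six: "card V = 3 * card M + 6" and large: "card M \<ge> 30000"
    and deg: "\<And>v. v \<in> V \<Longrightarrow> real (card (lk E v)) \<ge> (2/3 - 1/10000) * (real (card V))\<^sup>2"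
begin

lemma card_left: "card (V - \<Union>M) = 6"
  using matching_card_Union[OF tg M] six finV by (simp add: card_Diff_subset)

text \<open>With \<open>m = card M\<close>, the degrees fall short of the maximum
  \<open>24 * m^2\<close> by at most 36/10000 of \<open>m^2\<close>, and every non-tight pair uses
  up one unit. For \<open>m \<ge> 30000\<close> the linear terms fit into another 64/10000 of
  \<open>m^2\<close>.\<close>

lemma card_nontight:
  assumes Q: "distinct [x, y, z, t]" "{x, y, z, t} \<subseteq> V - \<Union>M"
  shows "real (card (nontight {x, y, z, t})) \<le> (real (card M))\<^sup>2 / 100"
proof -
  define m where "m = real (card M)"
  have n: "real (card V) = 3 * m + 6" using six by (simp add: m_def)
  have m: "m \<ge> 30000" using large by (simp add: m_def)
  have mem: "x \<in> V" "y \<in> V" "z \<in> V" "t \<in> V" "x \<notin> \<Union>M" "y \<notin> \<Union>M" "z \<notin> \<Union>M" "t \<notin> \<Union>M"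
    using Q(2) by blast+
  have "card (lk E x) + card (lk E y) + card (lk E z) + card (lk E t) + card (nontight {x, y, z, t})
    \<le> 24 * card M * card M + 12 * card M + 8 * 6 * card V"
    using degree_sum4[OF Q(1) mem(5-8)] card_left by simp
  then have "real (card (lk E x) + card (lk E y) + card (lk E z) + card (lk E t) + card (nontight {x, y, z, t}))
     \<le> real (24 * card M * card M + 12 * card M + 8 * 6 * card V)" by (rule of_nat_mono)
  then have 1: "real (card (lk E x)) + real (card (lk E y)) + real (card (lk E z)) + real (card (lk E t))
      + real (card (nontight {x, y, z, t})) \<le> 24 * m\<^sup>2 + 12 * m + 48 * (3 * m + 6)"
    using n by (simp add: m_def power2_eq_square)
  have "(2/3 - 1/10000) * (real (card V))\<^sup>2 \<ge> (2/3 - 1/10000) * (3 * m)\<^sup>2"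
    unfolding n using m by (intro mult_left_mono power_mono) auto
  then have 2: "(2/3 - 1/10000) * (real (card V))\<^sup>2 \<ge> 6 * m\<^sup>2 - 9/10000 * m\<^sup>2"
    by (simp add: power_mult_distrib field_simps)
  have "m * m \<ge> 30000 * m" using m by (intro mult_right_mono) auto
  then have "156 * m + 288 \<le> 64/10000 * m\<^sup>2" using m unfolding power2_eq_square by linarith
  moreover have "6 * m\<^sup>2 - 9/10000 * m\<^sup>2 \<le> real (card (lk E v))" if "v \<in> V" for v
    using 2 deg[OF that] by (rule order_trans)
  note this[OF mem(1)] this[OF mem(2)] this[OF mem(3)] this[OF mem(4)]
  ultimately show ?thesis using 1 unfolding m_def[symmetric] by (simp add: field_simps)
qed

end

section \<open>Exchanging uncovered and covered vertices\<close>

context stuck_matching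
begin

lemma row_unique:
  assumes "g \<in> M" "h \<in> M" "r \<in> g" "r' \<in> g" "row E v r g h" "row E v r' g h"
  shows "r' = r"
proof -
  obtain q where "q \<in> h" using edge_card[OF assms(2)] by fastforce
  then show ?thesis using assms unfolding row_def by blast
qed

lemma row_col_False:
  assumes "g \<in> M" "h \<in> M" "r \<in> g" "r' \<in> h" "row E v r g h" "row E v r' h g"
  shows False
proof -
  obtain p q where p: "{r, p, q} = g" "distinct [r, p, q]"
    using triple_with[OF edge_card[OF assms(1)] assms(3)] by metis
  then have pg: "p \<in> g" "p \<noteq> r" by auto
  have "{v, p, r'} \<in> E" using assms pg unfolding row_def by blast
  moreover have "{v, r', p} \<notin> E" using assms pg unfolding row_def by blast
  ultimately show False by (simp add: insert_commute)
qed

lemma row_edge: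
  assumes "g \<in> M" "h \<in> M" "r \<in> g" "row E v r g h"
  obtains p q where "p \<in> g" "q \<in> h" "{v, p, q} \<in> E"
proof -
  obtain p q where p: "{r, p, q} = g" "distinct [r, p, q]"
    using triple_with[OF edge_card[OF assms(1)] assms(3)] by metis
  then have pg: "p \<in> g" "p \<noteq> r" by auto
  obtain q where "q \<in> h" using edge_card[OF assms(2)] by fastforce
  then show ?thesis using that pg assms unfolding row_def by blast
qed

text \<open>This brings vertices of the matching into the uncovered set, so that the analysis of the
  links of uncovered vertices applies to them as well.\<close>

lemma swap_matching:
  assumes gh: "{r, s, s'} \<in> M" "{t, t1, t2} \<in> M" "{r, s, s'} \<noteq> {t, t1, t2}"
    and xy: "x \<noteq> y" "x \<notin> \<Union>M" "y \<notin> \<Union>M" "{x, s, t1} \<in> E" "{y, s', t2} \<in> E"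
  defines "M' \<equiv> M - {{r, s, s'}, {t, t1, t2}} \<union> {{x, s, t1}, {y, s', t2}}"
  shows "matching E M'" "card M' = card M" "r \<notin> \<Union>M'" "t \<notin> \<Union>M'"
    "\<Union>M' \<subseteq> \<Union>M \<union> {x, y}"
proof -
  let ?g = "{r, s, s'}" and ?h = "{t, t1, t2}"
  let ?N = "{{x, s, t1}, {y, s', t2}}"
  have dgh: "?g \<inter> ?h = {}" using M gh unfolding matching_def by (meson disjointD)
  have "?g \<in> E" "?h \<in> E" using gh M by (auto simp: matching_def)
  note d = three_graph_edge(1-3)[OF tg this(1)] three_graph_edge(1-3)[OF tg this(2)]
  have out: "x \<notin> ?g" "x \<notin> ?h" "y \<notin> ?g" "y \<notin> ?h" using gh xy by blast+
  have dN: "{x, s, t1} \<inter> {y, s', t2} = {}" using d dgh out xy(1) by auto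
  then have neq: "{x, s, t1} \<noteq> {y, s', t2}" by blast
  have N: "matching E ?N"
    unfolding matching_def using xy dN by (auto simp: pairwise_insert disjnt_def)
  have other: "c \<inter> ?g = {} \<and> c \<inter> ?h = {}" if "c \<in> M - {?g, ?h}" for c
    using M gh that unfolding matching_def by (metis DiffD1 DiffD2 disjointD insertI1 insert_iff)
  then have "\<Union>?N \<inter> \<Union>(M - {?g, ?h}) = {}" using xy(2,3) by fastforce
  note rep = matching_replace[OF tg M _ N this]
  show "matching E M'" unfolding M'_def using rep gh by blast
  have "card {?g, ?h} = 2" using gh by simp
  moreover have "card M \<ge> 2" using card_mono[of M "{?g, ?h}"] finM gh by simp
  moreover have "card ?N = 2" using neq by simp
  ultimately show "card M' = card M" unfolding M'_def using rep(2) gh by simp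
  show "\<Union>M' \<subseteq> \<Union>M \<union> {x, y}" unfolding M'_def using gh(1,2) by blast
  have rt: "r \<notin> \<Union>(M - {?g, ?h})" "t \<notin> \<Union>(M - {?g, ?h})" using other by blast+
  have "r \<notin> \<Union>?N" "t \<notin> \<Union>?N" using d dgh out by auto
  with rt show "r \<notin> \<Union>M'" "t \<notin> \<Union>M'" unfolding M'_def by simp_all
qed

end

context near_perfect
begin

text \<open>A swap along \<open>(g, h)\<close> uses up \<open>v0\<close>, \<open>v1\<close> and
  leaves \<open>u\<close> uncovered next to \<open>v2\<close>, \<open>v3\<close>, \<open>v4\<close>,
  so \<open>card_nontight\<close> applies to the new matching. Only pairs involving \<open>g\<close>
  or \<open>h\<close> escape it, at most \<open>4 * card M\<close> of them; hence 1/50 in place of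
  1/100.\<close>

lemma freed_card_nontight:
  assumes gh: "g \<in> M" "h \<in> M" "g \<noteq> h" "r \<in> g" "row E v0 r g h" "row E v1 r g h"
    and u: "u = r \<or> u \<in> h"
    and v: "distinct [v0, v1, v2, v3, v4]" "{v0, v1, v2, v3, v4} \<subseteq> V - \<Union>M"
  shows "real (card (nontight {u, v2, v3, v4})) \<le> (real (card M))\<^sup>2 / 50"
proof -
  obtain s s' where g: "{r, s, s'} = g" "distinct [r, s, s']"
    using triple_with[OF edge_card[OF gh(1)] gh(4)] by metis
  \<comment> \<open>If \<open>u = r\<close>, an arbitrary vertex of \<open>h\<close> is freed along
    with it.\<close>
  obtain t where t: "t \<in> h" "u = r \<or> u = t"
  proof (cases "u = r")
    case True
    obtain t where "t \<in> h" using edge_card[OF gh(2)] by fastforce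
    then show ?thesis using that True by blast
  qed (use u that in blast)
  obtain t1 t2 where h: "{t, t1, t2} = h" "distinct [t, t1, t2]"
    using triple_with[OF edge_card[OF gh(2)] t(1)] by metis
  have e: "{v0, s, t1} \<in> E" "{v1, s', t2} \<in> E"
    using gh g h unfolding row_def by auto
  have v01: "v0 \<noteq> v1" "v0 \<notin> \<Union>M" "v1 \<notin> \<Union>M" using v by auto
  define M' where "M' = M - {g, h} \<union> {{v0, s, t1}, {v1, s', t2}}"
  have sw: "matching E M'" "card M' = card M" "r \<notin> \<Union>M'" "t \<notin> \<Union>M'" "\<Union>M' \<subseteq> \<Union>M \<union> {v0, v1}"
    using swap_matching[of r s s' t t1 t2 v0 v1] gh g h e v01 unfolding M'_def by simp_all
  interpret S: near_perfect V E M'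
    by unfold_locales (use tg sw mx six large deg in simp_all)
  have uM: "u \<in> \<Union>M" using t gh by auto
  then have "u \<in> V" using matching_card_Union(2)[OF tg M] by blast
  then have Q: "{u, v2, v3, v4} \<subseteq> V - \<Union>M'" "distinct [u, v2, v3, v4]"
    using v uM t(2) sw(3-5) by auto
  have "nontight {u, v2, v3, v4} \<subseteq> S.nontight {u, v2, v3, v4} \<union> ({g, h} \<times> M \<union> M \<times> {g, h})"
  proof
    fix x assume x: "x \<in> nontight {u, v2, v3, v4}"
    then obtain a b where ab: "x = (a, b)" "a \<in> M" "b \<in> M" "a \<noteq> b" "\<not> tight {u, v2, v3, v4} a b"
      unfolding nontight_def by blast
    show "x \<in> S.nontight {u, v2, v3, v4} \<union> ({g, h} \<times> M \<union> M \<times> {g, h})"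
    proof (cases "a \<in> {g, h} \<or> b \<in> {g, h}")
      case False
      then have "a \<in> M'" "b \<in> M'" using ab unfolding M'_def by blast+
      then show ?thesis using ab(1,4,5) unfolding S.nontight_def by blast
    qed (use ab in blast)
  qed
  then have "card (nontight {u, v2, v3, v4}) \<le> card (S.nontight {u, v2, v3, v4} \<union> ({g, h} \<times> M \<union> M \<times> {g, h}))"
    using finM S.finite_nontight by (intro card_mono) auto
  also have "\<dots> \<le> card (S.nontight {u, v2, v3, v4}) + (card ({g, h} \<times> M) + card (M \<times> {g, h}))"
    by (rule order_trans[OF card_Un_le add_left_mono[OF card_Un_le]])
  also have "\<dots> = card (S.nontight {u, v2, v3, v4}) + 4 * card M"
    using gh(3) by (simp add: card_cartesian_product)
  finally have "real (card (nontight {u, v2, v3, v4})) \<le> real (card (S.nontight {u, v2, v3, v4})) + 4 * real (card M)"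
    by linarith
  also have "real (card (S.nontight {u, v2, v3, v4})) \<le> (real (card M))\<^sup>2 / 100"
    using S.card_nontight[OF Q(2,1)] sw(2) by simp
  also have "4 * real (card M) \<le> (real (card M))\<^sup>2 / 100"
  proof -
    have "400 * real (card M) \<le> real (card M) * real (card M)" using large by (intro mult_right_mono) auto
    then show ?thesis by (simp add: power2_eq_square)
  qed
  finally show ?thesis by simp
qed

text \<open>Count triples \<open>(g', g, h)\<close> of matching edges. On a tight pair
  \<open>(g, h)\<close> the links miss a line \<open>r \<in> g\<close>. If the vertices of
  \<open>g'\<close> miss it as well, the link of \<open>r\<close> is empty on
  \<open>g' \<times> h\<close>, so \<open>(g', h)\<close> is not tight for \<open>r\<close>. Such
  triples are of cubic number, while non-tight pairs are too few.\<close>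

lemma contradiction: False
proof -
  define m where "m = real (card M)"
  have m: "m \<ge> 30000" using large by (simp add: m_def)
  \<comment> \<open>Two of the five vertices are spent on a swap; the other three accompany the
    freed vertex.\<close>
  have "5 \<le> card (V - \<Union>M)" using card_left by simp
  then obtain T where T: "T \<subseteq> V - \<Union>M" "card T = 5" by (rule obtain_subset_with_card_n)
  have "finite T" using T(2) by (auto intro: card_ge_0_finite)
  then obtain vs where vs: "set vs = T" "distinct vs" using finite_distinct_list by blast
  have "length vs = 5" using distinct_card[OF vs(2)] vs(1) T(2) by simp
  then obtain v0 v1 v2 v3 v4 where vv: "vs = [v0, v1, v2, v3, v4]"
    by (auto simp: numeral_eq_Suc length_Suc_conv)
  have v: "distinct [v0, v1, v2, v3, v4]" "{v0, v1, v2, v3, v4} \<subseteq> V - \<Union>M"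
    using vs T vv by auto
  \<comment> \<open>\<open>v0\<close> and \<open>v1\<close> make the swap along
    \<open>(g, h)\<close> possible; \<open>v2\<close> identifies \<open>r\<close> as the line of any
    other vertex that is tight together with it.\<close>
  define arc where "arc r g h \<longleftrightarrow> g \<in> M \<and> h \<in> M \<and> g \<noteq> h \<and> r \<in> g \<and> (\<forall>w\<in>{v0, v1, v2, v3}. row E w r g h)"
    for r g h
  define P where "P = {(g, h). \<exists>r. arc r g h}"
  define R where "R = snd ` P"
  define NT where "NT u = nontight {u, v2, v3, v4}" for u
  have PM: "P \<subseteq> M \<times> M" by (auto simp: P_def arc_def)
  have finP: "finite P" by (rule finite_subset[OF PM]) (simp add: finM)
  have RM: "R \<subseteq> M" using PM by (auto simp: R_def)
  have finR: "finite R" using RM finM by (rule finite_subset)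
  have finNT: "finite (NT u)" for u by (simp add: NT_def finite_nontight)
  have NT: "real (card (NT u)) \<le> m\<^sup>2 / 50" if "arc r g h" "u = r \<or> u \<in> h" for u r g h
    unfolding NT_def m_def using that(1) v unfolding arc_def
    by (intro freed_card_nontight[of g h r v0 v1 u v2 v3 v4] that(2)) auto

  \<comment> \<open>Apart from the diagonal and at most \<open>m^2 / 100\<close> non-tight pairs,
    every pair is an arc in one of its two directions, so almost half of all ordered pairs are
    arcs.\<close>
  have "M \<times> M \<subseteq> P \<union> prod.swap ` P \<union> (nontight {v0, v1, v2, v3} \<union> Id_on M)"
  proof
    fix x assume "x \<in> M \<times> M"
    then obtain g h where x: "x = (g, h)" "g \<in> M" "h \<in> M" by blast
    show "x \<in> P \<union> prod.swap ` P \<union> (nontight {v0, v1, v2, v3} \<union> Id_on M)"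
    proof (cases "g = h \<or> x \<in> nontight {v0, v1, v2, v3}")
      case False
      then have "tight {v0, v1, v2, v3} g h" "g \<noteq> h" using x by (auto simp: nontight_def)
      then have "(g, h) \<in> P \<or> (h, g) \<in> P" unfolding tight_def P_def arc_def using x by blast
      then show ?thesis using x by force
    qed (use x in auto)
  qed
  then have "card (M \<times> M) \<le> card (P \<union> prod.swap ` P \<union> (nontight {v0, v1, v2, v3} \<union> Id_on M))"
    using finP finM finite_nontight by (intro card_mono) (auto simp: Id_on_def)
  also have "\<dots> \<le> (card P + card (prod.swap ` P)) + (card (nontight {v0, v1, v2, v3}) + card (Id_on M))"
    by (rule order_trans[OF card_Un_le add_mono[OF card_Un_le card_Un_le]])
  also have "card (prod.swap ` P) \<le> card P" using finP by (rule card_image_le)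
  also have "card (Id_on M) \<le> card M"
  proof -
    have "Id_on M = (\<lambda>x. (x, x)) ` M" by auto
    then show ?thesis using card_image_le[OF finM] by simp
  qed
  finally have "real (card M * card M) \<le> real (2 * card P + card (nontight {v0, v1, v2, v3}) + card M)"
    unfolding card_cartesian_product by linarith
  moreover have "real (card (nontight {v0, v1, v2, v3})) \<le> m\<^sup>2 / 100"
    unfolding m_def using v by (intro card_nontight) auto
  moreover have mm: "100 * m \<le> m\<^sup>2" unfolding power2_eq_square using m by (intro mult_right_mono) auto
  ultimately have cP: "real (card P) \<ge> 49/100 * m\<^sup>2"
    unfolding m_def by (simp add: power2_eq_square)

  have "P \<subseteq> M \<times> R" using PM by (force simp: R_def)
  then have "card P \<le> card M * card R"
    using card_mono[of "M \<times> R" P] finM finR by (simp add: card_cartesian_product)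
  then have "real (card P) \<le> m * real (card R)" unfolding m_def by (metis of_nat_le_iff of_nat_mult)
  with cP have "m * (49/100 * m) \<le> m * real (card R)" by (simp add: power2_eq_square)
  then have cR: "real (card R) \<ge> 49/100 * m" using m by simp

  \<comment> \<open>Elements of \<open>R\<close> are heads of arcs, so each of their vertices can be
    freed and obeys the bound on \<open>NT\<close>. Discarding at most \<open>3 * (m^2 / 50)\<close>
    arcs for each \<open>g'\<close> leaves 49/100 - 6/100 = 43/100 of \<open>m^2\<close>.\<close>
  define G where "G = {(g', x). g' \<in> R \<and> x \<in> P \<and> (\<forall>u\<in>g'. x \<notin> NT u)}"
  have g3: "card g = 3 \<and> finite g" if "g \<in> M" for g
    using edge_card[OF that] by (auto intro: card_ge_0_finite)
  have "R \<times> P \<subseteq> G \<union> (SIGMA g':R. \<Union>u\<in>g'. NT u)" unfolding G_def by auto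
  moreover have finG: "finite G"
    by (rule finite_subset[of _ "R \<times> P"]) (use finR finP in \<open>auto simp: G_def\<close>)
  ultimately have "card (R \<times> P) \<le> card G + card (SIGMA g':R. \<Union>u\<in>g'. NT u)"
    using finR finNT g3 RM
    by (intro order_trans[OF card_mono card_Un_le]) (auto intro!: finite_SigmaI)
  also have "card (SIGMA g':R. \<Union>u\<in>g'. NT u) = (\<Sum>g'\<in>R. card (\<Union>u\<in>g'. NT u))"
    using finR finNT g3 RM by (intro card_SigmaI) auto
  finally have "real (card R) * real (card P) \<le> real (card G) + (\<Sum>g'\<in>R. real (card (\<Union>u\<in>g'. NT u)))"
    unfolding card_cartesian_product of_nat_sum[symmetric] of_nat_add[symmetric] of_nat_mult[symmetric]
    by (rule of_nat_mono)
  also have "(\<Sum>g'\<in>R. real (card (\<Union>u\<in>g'. NT u))) \<le> (\<Sum>g'\<in>R. 3 * (m\<^sup>2 / 50))"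
  proof (rule sum_mono)
    fix g' assume g': "g' \<in> R"
    then obtain r g where a: "arc r g g'" by (auto simp: R_def P_def)
    have "card (\<Union>u\<in>g'. NT u) \<le> (\<Sum>u\<in>g'. card (NT u))"
      using g3 g' RM by (intro card_UN_le) auto
    then have "real (card (\<Union>u\<in>g'. NT u)) \<le> (\<Sum>u\<in>g'. real (card (NT u)))"
      unfolding of_nat_sum[symmetric] by (rule of_nat_mono)
    also have "\<dots> \<le> (\<Sum>u\<in>g'. m\<^sup>2 / 50)" using NT[OF a] by (intro sum_mono) auto
    also have "\<dots> = 3 * (m\<^sup>2 / 50)" using g3 g' RM by auto
    finally show "real (card (\<Union>u\<in>g'. NT u)) \<le> 3 * (m\<^sup>2 / 50)" .
  qed
  finally have G1: "real (card R) * (real (card P) - 3 * (m\<^sup>2 / 50)) \<le> real (card G)"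
    by (simp add: algebra_simps)
  have "(49/100 * m) * (43/100 * m\<^sup>2) \<le> real (card R) * (real (card P) - 3 * (m\<^sup>2 / 50))"
    using cR cP m by (intro mult_mono) auto
  with G1 have G2: "(49/100 * m) * (43/100 * m\<^sup>2) \<le> real (card G)" by linarith

  \<comment> \<open>For the upper bound, triples are regrouped by \<open>g\<close>: the pair
    \<open>(g', h)\<close> lies on the diagonal or in \<open>NT r\<close> for one of at most three
    vertices \<open>r\<close> of \<open>g\<close>.\<close>
  define f where "f = (\<lambda>(g', g, h). (g :: 'a set, g' :: 'a set, h :: 'a set))"
  let ?D = "\<lambda>g. (\<Union>r\<in>{r \<in> g. \<exists>h. arc r g h}. NT r) \<union> Id_on M"
  have inj: "inj_on f G" by (auto simp: inj_on_def f_def)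
  have "f ` G \<subseteq> (SIGMA g:M. ?D g)"
  proof
    fix y assume "y \<in> f ` G"
    then obtain g' g h where y: "y = (g, g', h)" and gG: "(g', g, h) \<in> G" by (auto simp: f_def)
    then have g'R: "g' \<in> R" and gP: "(g, h) \<in> P" and nNT: "\<And>u. u \<in> g' \<Longrightarrow> (g, h) \<notin> NT u"
      by (auto simp: G_def)
    from gP obtain r where r: "arc r g h" by (auto simp: P_def)
    have gh: "g \<in> M" "h \<in> M" "g \<noteq> h" "r \<in> g" "row E v2 r g h" using r by (auto simp: arc_def)
    \<comment> \<open>The pair \<open>(g, h)\<close> is tight for \<open>u\<close> together with
      \<open>v2\<close>, whose line is \<open>r\<close>, so \<open>u\<close> misses this line too.
      Seen from \<open>r\<close>, its own link is empty on \<open>g' \<times> h\<close>.\<close>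
    have non: "{r, u, t} \<notin> E" if "u \<in> g'" "t \<in> h" for u t
    proof -
      have "tight {u, v2, v3, v4} g h" using nNT[OF that(1)] gh unfolding NT_def nontight_def by blast
      then have "row E u r g h"
        unfolding tight_def using row_unique[OF gh(1,2,4) _ gh(5)] row_col_False[OF gh(1,2,4) _ gh(5)] by blast
      then have "{u, r, t} \<notin> E" using gh that unfolding row_def by blast
      then show ?thesis by (simp add: insert_commute)
    qed
    \<comment> \<open>A tight block contains an edge by \<open>row_edge\<close>, and this one
      contains none.\<close>
    have "(g', h) \<in> NT r" if "g' \<noteq> h"
    proof (rule ccontr)
      assume "(g', h) \<notin> NT r"
      moreover have g'M: "g' \<in> M" using g'R RM by blast
      ultimately have "tight {r, v2, v3, v4} g' h" using that gh unfolding NT_def nontight_def by blast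
      then consider r' where "r' \<in> g'" "row E r r' g' h" | r' where "r' \<in> h" "row E r r' h g'"
        unfolding tight_def by blast
      then show False
      proof cases
        case 1
        then show False using row_edge[OF g'M gh(2)] non by metis
      next
        case 2
        then obtain p q where "p \<in> h" "q \<in> g'" "{r, p, q} \<in> E" using row_edge[OF gh(2) g'M] by metis
        then show False using non[of q p] by (simp add: insert_commute)
      qed
    qed
    then have "(g', h) \<in> ?D g" using r gh by (cases "g' = h") auto
    then show "y \<in> (SIGMA g:M. ?D g)" using y gh by blast
  qed
  moreover have finD: "finite (?D g)" if "g \<in> M" for g
    using g3[OF that] finNT finM by (auto simp: Id_on_def)
  ultimately have "card (f ` G) \<le> card (SIGMA g:M. ?D g)"
    using finM by (intro card_mono) (auto intro!: finite_SigmaI)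
  also have "\<dots> = (\<Sum>g\<in>M. card (?D g))" using finM finD by (intro card_SigmaI) auto
  finally have "real (card G) \<le> (\<Sum>g\<in>M. real (card (?D g)))"
    unfolding card_image[OF inj] of_nat_sum[symmetric] by (rule of_nat_mono)
  also have "\<dots> \<le> (\<Sum>g\<in>M. 3 * (m\<^sup>2 / 50) + m)"
  proof (rule sum_mono)
    fix g assume g: "g \<in> M"
    let ?A = "{r \<in> g. \<exists>h. arc r g h}"
    have A: "finite ?A" "card ?A \<le> 3" using g3[OF g] card_mono[of g ?A] by auto
    have "card (?D g) \<le> card (\<Union>r\<in>?A. NT r) + card (Id_on M)" by (rule card_Un_le)
    also have "card (\<Union>r\<in>?A. NT r) \<le> (\<Sum>r\<in>?A. card (NT r))" using A(1) by (intro card_UN_le) auto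
    finally have "real (card (?D g)) \<le> (\<Sum>r\<in>?A. real (card (NT r))) + real (card (Id_on M))"
      unfolding of_nat_sum[symmetric] of_nat_add[symmetric] by (intro of_nat_mono) simp
    also have "(\<Sum>r\<in>?A. real (card (NT r))) \<le> (\<Sum>r\<in>?A. m\<^sup>2 / 50)"
      using NT by (intro sum_mono) blast
    also have "\<dots> \<le> 3 * (m\<^sup>2 / 50)" using A(2) by (simp add: mult_right_mono)
    also have "real (card (Id_on M)) \<le> m"
    proof -
      have "Id_on M = (\<lambda>x. (x, x)) ` M" by auto
      then show ?thesis using card_image_le[OF finM] unfolding m_def by simp
    qed
    finally show "real (card (?D g)) \<le> 3 * (m\<^sup>2 / 50) + m" by simp
  qed
  also have "\<dots> = m * (3 * (m\<^sup>2 / 50) + m)" by (simp add: m_def)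
  also have "\<dots> \<le> m * (7/100 * m\<^sup>2)" using mm m by (intro mult_left_mono) auto
  \<comment> \<open>The two counts clash, since 49/100 * 43/100 exceeds 7/100.\<close>
  finally have "m * (49/100 * (43/100 * m\<^sup>2)) \<le> m * (7/100 * m\<^sup>2)" using G2 by (simp add: algebra_simps)
  moreover have "m\<^sup>2 > 0" using m by simp
  ultimately show False using m by simp
qed

end

section \<open>Matchings that miss three vertices\<close>

text \<open>Take an edge-maximal hypergraph without a \<open>k\<close>-matching inside the class
  \<open>C\<close>. Adding a missing triple \<open>e\<close> creates such a matching; it must use
  \<open>e\<close>, and its other edges avoid \<open>e\<close>.\<close>

lemma saturate:
  assumes tg: "three_graph V C" and EC: "E \<subseteq> C" and no: "\<nexists>M. matching E M \<and> card M = k"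
  obtains E' where "E \<subseteq> E'" "E' \<subseteq> C" "\<nexists>M. matching E' M \<and> card M = k"
    "\<And>e. e \<in> C - E' \<Longrightarrow> \<exists>M. matching E' M \<and> Suc (card M) = k \<and> e \<inter> \<Union>M = {}"
proof -
  define P where "P E' \<longleftrightarrow> E \<subseteq> E' \<and> E' \<subseteq> C \<and> (\<nexists>M. matching E' M \<and> card M = k)" for E'
  have "finite {E'. P E'}"
    by (rule finite_subset[of _ "Pow C"]) (use three_graph_finite[OF tg] in \<open>auto simp: P_def\<close>)
  moreover have "E \<in> {E'. P E'}" using EC no by (simp add: P_def)
  ultimately have "\<exists>E'\<in>{E'. P E'}. E \<subseteq> E' \<and> (\<forall>F\<in>{E'. P E'}. E' \<subseteq> F \<longrightarrow> E' = F)"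
    by (rule finite_has_maximal2[where A = "{E'. P E'}" and a = E])
  then obtain E' where m: "E' \<in> {E'. P E'}" "\<forall>F\<in>{E'. P E'}. E' \<subseteq> F \<longrightarrow> E' = F"
    by (elim bexE conjE)
  then have PE': "P E'" by simp
  have mx: "E' = F" if "P F" "E' \<subseteq> F" for F using m(2) that by simp
  have E': "E \<subseteq> E'" "E' \<subseteq> C" "\<nexists>M. matching E' M \<and> card M = k" using PE' by (simp_all add: P_def)
  have "\<exists>M. matching E' M \<and> Suc (card M) = k \<and> e \<inter> \<Union>M = {}" if e: "e \<in> C - E'" for e
  proof -
    have "\<not> P (insert e E')" using mx[of "insert e E'"] e by blast
    moreover have sub: "E \<subseteq> insert e E'" "insert e E' \<subseteq> C" using E'(1,2) e by blast+
    ultimately obtain M where M: "matching (insert e E') M" "card M = k" unfolding P_def by blast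
    have eM: "e \<in> M"
    proof (rule ccontr)
      assume "e \<notin> M"
      then have "matching E' M" using M(1) unfolding matching_def by blast
      then show False using E'(3) M(2) by blast
    qed
    have "M \<subseteq> C" using M(1) sub(2) unfolding matching_def by blast
    then have "finite M" using three_graph_finite[OF tg] by (rule finite_subset)
    then have "Suc (card (M - {e})) = k" using eM M(2) card_Suc_Diff1[of M e] by simp
    moreover have "disjoint (M - {e})" using M(1) unfolding matching_def by (blast intro: pairwise_subset)
    then have "matching E' (M - {e})" using M(1) unfolding matching_def by blast
    moreover have "e \<inter> d = {}" if "d \<in> M - {e}" for d
      using M(1) eM that disjointD[of M e d] unfolding matching_def by auto
    then have "e \<inter> \<Union>(M - {e}) = {}" by blast
    ultimately show ?thesis by blast
  qed
  then show ?thesis by (rule that[OF E'])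
qed

section \<open>Matchings built from stars\<close>

lemma star_matching:
  assumes "finite Z" "inj_on r Z" "inj_on s Z" "Z \<inter> r ` Z = {}" "Z \<inter> s ` Z = {}" "r ` Z \<inter> s ` Z = {}"
    and E: "\<And>z. z \<in> Z \<Longrightarrow> {z, r z, s z} \<in> E"
  defines "M \<equiv> (\<lambda>z. {z, r z, s z}) ` Z"
  shows "matching E M" "card M = card Z" "\<Union>M = Z \<union> r ` Z \<union> s ` Z"
proof -
  have dis: "{z, r z, s z} \<inter> {z', r z', s z'} = {}" if "z \<in> Z" "z' \<in> Z" "z \<noteq> z'" for z z'
  proof -
    have "r z \<noteq> r z'" "s z \<noteq> s z'" using that assms(2,3) inj_on_eq_iff by metis+
    moreover have "z \<noteq> r z'" "z' \<noteq> r z" "z \<noteq> s z'" "z' \<noteq> s z" "r z \<noteq> s z'" "r z' \<noteq> s z"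
      using that(1,2) assms(4-6) by blast+
    ultimately show ?thesis using that(3) by simp
  qed
  have "disjoint M" unfolding M_def
  proof (rule pairwiseI)
    fix a b assume "a \<in> (\<lambda>z. {z, r z, s z}) ` Z" "b \<in> (\<lambda>z. {z, r z, s z}) ` Z" "a \<noteq> b"
    then obtain z z' where "z \<in> Z" "z' \<in> Z" "a = {z, r z, s z}" "b = {z', r z', s z'}" "z \<noteq> z'" by auto
    then show "disjnt a b" using dis[of z z'] unfolding disjnt_def by simp
  qed
  moreover have "M \<subseteq> E" unfolding M_def using E by auto
  ultimately show "matching E M" unfolding matching_def by simp
  have "inj_on (\<lambda>z. {z, r z, s z}) Z"
  proof (rule inj_onI, rule ccontr)
    fix z z' assume "z \<in> Z" "z' \<in> Z" "{z, r z, s z} = {z', r z', s z'}" "z \<noteq> z'"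
    then show False using dis[of z z'] by simp
  qed
  then show "card M = card Z" unfolding M_def by (rule card_image)
  show "\<Union>M = Z \<union> r ` Z \<union> s ` Z" unfolding M_def by blast
qed

text \<open>Once the second vertices \<open>r z\<close> are fixed, any bijection onto the rest of
  \<open>Y\<close> supplies the third ones.\<close>

lemma star_matching_extend:
  assumes fin: "finite Z" "finite Y" and ZY: "Z \<inter> Y = {}" "card Y = 2 * card Z"
    and r: "inj_on r Z" "r ` Z \<subseteq> Y"
    and E: "\<And>z y. z \<in> Z \<Longrightarrow> y \<in> Y - r ` Z \<Longrightarrow> {z, r z, y} \<in> E"
  obtains M where "matching E M" "card M = card Z" "\<Union>M = Z \<union> Y"
proof -
  have "card (Y - r ` Z) = card Z" using fin r ZY by (simp add: card_Diff_subset card_image)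
  then obtain s where s: "bij_betw s Z (Y - r ` Z)"
    using finite_same_card_bij[of Z "Y - r ` Z"] fin by auto
  then have s': "inj_on s Z" "s ` Z = Y - r ` Z" by (auto simp: bij_betw_def)
  have d: "Z \<inter> r ` Z = {}" "Z \<inter> s ` Z = {}" "r ` Z \<inter> s ` Z = {}" using s' r ZY by auto
  have e: "{z, r z, s z} \<in> E" if "z \<in> Z" for z using E[of z "s z"] that s' by auto
  note st = star_matching[of Z r s E, OF fin(1) r(1) s'(1) d e]
  have "Z \<union> r ` Z \<union> s ` Z = Z \<union> Y" using s'(2) r(2) by auto
  with st(3) show ?thesis by (intro that[OF st(1,2)]) simp_all
qed

lemma complete_star_matching:
  assumes fin: "finite Z" "finite Y" and ZY: "Z \<inter> Y = {}" "card Y = 2 * card Z"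
    and E: "\<And>z y y'. z \<in> Z \<Longrightarrow> y \<in> Y \<Longrightarrow> y' \<in> Y \<Longrightarrow> y \<noteq> y' \<Longrightarrow> {z, y, y'} \<in> E"
  obtains M where "matching E M" "card M = card Z" "\<Union>M = Z \<union> Y"
proof -
  have "card Z \<le> card Y" using ZY by simp
  then obtain r where r: "r ` Z \<subseteq> Y" "inj_on r Z" using card_le_inj[OF fin] by blast
  show ?thesis
  proof (rule star_matching_extend[OF fin ZY r(2,1), of E])
    fix z y assume "z \<in> Z" "y \<in> Y - r ` Z"
    then show "{z, r z, y} \<in> E" using r by (intro E) auto
  qed (rule that)
qed

lemma three_graph_complete: "finite V \<Longrightarrow> three_graph V {e. e \<subseteq> V \<and> card e = 3}"
  by (simp add: three_graph_def)

lemma complete_matching: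
  assumes "finite V" "3 * k \<le> card V"
  shows "\<exists>M. matching {e. e \<subseteq> V \<and> card e = 3} M \<and> card M = k"
proof -
  have "k \<le> card V" using assms(2) by linarith
  then obtain Z where Z: "Z \<subseteq> V" "card Z = k" "finite Z" by (rule obtain_subset_with_card_n)
  have "2 * k \<le> card (V - Z)" using assms Z by (simp add: card_Diff_subset)
  then obtain Y where Y: "Y \<subseteq> V - Z" "card Y = 2 * k" "finite Y" by (rule obtain_subset_with_card_n)
  have "{z, y, y'} \<in> {e. e \<subseteq> V \<and> card e = 3}" if "z \<in> Z" "y \<in> Y" "y' \<in> Y" "y \<noteq> y'" for z y y'
    using that Z Y by (auto simp: card3_iff)
  note E = this
  have "Z \<inter> Y = {}" "card Y = 2 * card Z" using Z Y by auto
  then obtain M where "matching {e. e \<subseteq> V \<and> card e = 3} M" "card M = card Z"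
    by (rule complete_star_matching[OF Z(3) Y(3) _ _ E])
  then show ?thesis using Z(2) by auto
qed

text \<open>In an edge-maximal counterexample degrees have only grown, and a missing triple yields a
  matching one edge short of the target size. It leaves six vertices uncovered and cannot be
  enlarged, which rigidity excludes.\<close>

theorem near_perfect_matching:
  assumes tg: "three_graph V E" and dv: "3 dvd card V" and large: "card V \<ge> 90006"
    and deg: "\<And>v. v \<in> V \<Longrightarrow> real (card (lk E v)) \<ge> (2/3 - 1/10000) * (real (card V))\<^sup>2"
  shows "\<exists>M. matching E M \<and> card M = card V div 3 - 1"
proof (rule ccontr)
  assume no: "\<nexists>M. matching E M \<and> card M = card V div 3 - 1"
  let ?C = "{e. e \<subseteq> V \<and> card e = 3}"
  have fin: "finite V" using tg by (simp add: three_graph_def)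
  note tgC = three_graph_complete[OF fin]
  have EC: "E \<subseteq> ?C" using tg by (auto simp: three_graph_def)
  obtain E' where E': "E \<subseteq> E'" "E' \<subseteq> ?C" "\<nexists>M. matching E' M \<and> card M = card V div 3 - 1"
    and sat: "\<And>e. e \<in> ?C - E' \<Longrightarrow> \<exists>M. matching E' M \<and> Suc (card M) = card V div 3 - 1 \<and> e \<inter> \<Union>M = {}"
    by (rule saturate[OF tgC EC no]) blast
  have "E' \<noteq> ?C" using complete_matching[OF fin, of "card V div 3 - 1"] E'(3) by fastforce
  then obtain e where "e \<in> ?C - E'" using E'(2) by blast
  from sat[OF this] obtain M where M: "matching E' M" "Suc (card M) = card V div 3 - 1" by blast
  have tg': "three_graph V E'" using E'(2) fin by (auto simp: three_graph_def)
  have "card V = 3 * card M + 6" "card M \<ge> 30000" using M(2) dv large by auto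
  moreover have "real (card (lk E' v)) \<ge> (2/3 - 1/10000) * (real (card V))\<^sup>2" if "v \<in> V" for v
  proof -
    have "card (lk E v) \<le> card (lk E' v)" using lk_mono[OF E'(1)] finite_lk[OF tg'] by (intro card_mono) auto
    then show ?thesis using deg[OF that] by linarith
  qed
  ultimately have "near_perfect V E' M"
    using tg' M E'(3) by unfold_locales auto
  then show False by (rule near_perfect.contradiction)
qed

lemma three_graph_induced:
  "three_graph V E \<Longrightarrow> V' \<subseteq> V \<Longrightarrow> three_graph V' {e \<in> E. e \<subseteq> V'}"
  by (simp add: three_graph_def finite_subset)

lemma card_lk_induced:
  assumes tg: "three_graph V E" and "V' \<subseteq> V" "v \<in> V'"
  shows "card (lk E v) \<le> card (lk {e \<in> E. e \<subseteq> V'} v) + 2 * card (V - V') * card V"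
proof -
  have fin: "finite V" using tg by (simp add: three_graph_def)
  have "lk E v \<subseteq> lk {e \<in> E. e \<subseteq> V'} v \<union> ((V - V') \<times> V \<union> V \<times> (V - V'))"
    using lk_subset[OF tg, of v] assms(3) by (auto simp: lk_def)
  then have "card (lk E v) \<le> card (lk {e \<in> E. e \<subseteq> V'} v \<union> ((V - V') \<times> V \<union> V \<times> (V - V')))"
    using fin finite_lk[OF three_graph_induced[OF tg assms(2)]] by (intro card_mono) auto
  also have "\<dots> \<le> card (lk {e \<in> E. e \<subseteq> V'} v) + (card ((V - V') \<times> V) + card (V \<times> (V - V')))"
    by (rule order_trans[OF card_Un_le add_left_mono[OF card_Un_le]])
  finally show ?thesis by (simp add: card_cartesian_product algebra_simps)
qed

section \<open>Absorption\<close>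

text \<open>Used for three edges \<open>N\<close>, whose nine vertices together with
  \<open>x\<close>, \<open>y\<close>, \<open>z\<close> carry four disjoint edges. The premise lets
  degenerate triples and triples meeting \<open>N\<close> count as absorbed, so that counting can
  run over all of \<open>V \<times> V \<times> V\<close>.\<close>

definition absorbs :: "'a set set \<Rightarrow> 'a set set \<Rightarrow> 'a \<Rightarrow> 'a \<Rightarrow> 'a \<Rightarrow> bool" where
  "absorbs E N x y z \<longleftrightarrow> (distinct [x, y, z] \<and> {x, y, z} \<inter> \<Union>N = {} \<longrightarrow>
     (\<exists>N'. matching E N' \<and> card N' = 4 \<and> \<Union>N' = \<Union>N \<union> {x, y, z}))"

text \<open>Double counting of \<open>R\<close>: each \<open>i\<close> is related to at least a
  quarter of \<open>K\<close>, so an average element of \<open>K\<close> is related to a quarter of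
  \<open>I\<close>. The separate bound \<open>c\<close> can be taken as
  \<open>card V * card V\<close>.\<close>

lemma averaging:
  assumes fin: "finite I" "finite K" and le: "card K \<le> c" and K: "K \<noteq> {}"
    and many: "\<And>i. i \<in> I \<Longrightarrow> c \<le> 4 * card {k \<in> K. R i k}"
  obtains k where "k \<in> K" "card I \<le> 4 * card {i \<in> I. R i k}"
proof -
  have "\<exists>k\<in>K. card I \<le> 4 * card {i \<in> I. R i k}"
  proof (rule ccontr)
    assume "\<not> ?thesis"
    then have lt: "4 * card {i \<in> I. R i k} < card I" if "k \<in> K" for k using that by force
    have "(\<Sum>k\<in>K. 4 * card {i \<in> I. R i k}) < (\<Sum>k\<in>K. card I)"
      using fin K lt by (intro sum_strict_mono) auto
    also have "\<dots> \<le> c * card I" using le by simp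
    also have "\<dots> = (\<Sum>i\<in>I. c)" by simp
    also have "\<dots> \<le> (\<Sum>i\<in>I. 4 * card {k \<in> K. R i k})" using many by (rule sum_mono)
    also have "\<dots> = 4 * (\<Sum>i\<in>I. \<Sum>k\<in>K. of_bool (R i k))"
      using fin by (simp add: sum_distrib_left Int_def)
    also have "(\<Sum>i\<in>I. \<Sum>k\<in>K. of_bool (R i k)) = (\<Sum>k\<in>K. \<Sum>i\<in>I. of_bool (R i k) :: nat)" by (rule sum.swap)
    also have "4 * \<dots> = (\<Sum>k\<in>K. 4 * card {i \<in> I. R i k})"
      using fin by (simp add: sum_distrib_left Int_def)
    finally show False by simp
  qed
  then show ?thesis using that by blast
qed

locale dense_graph =
  fixes V :: "'a set" and E
  assumes tg: "three_graph V E" and ne: "V \<noteq> {}"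
    and deg: "\<And>v. v \<in> V \<Longrightarrow> real (card (lk E v)) \<ge> (2/3 - 1/20000) * (real (card V))\<^sup>2"
begin

lemma finV: "finite V" using tg by (simp add: three_graph_def)

text \<open>Two links of density almost 2/3 overlap in density almost 1/3. Pairs meeting
  \<open>F\<close> have density at most 2/100, so more than 1/4 is left.\<close>

lemma many_common_pairs:
  assumes a: "a \<in> V" and x: "x \<in> V" and F: "F \<subseteq> V" "100 * card F \<le> card V"
  shows "card V * card V \<le> 4 * card (lk E a \<inter> lk E x \<inter> (V - F) \<times> (V - F))"
proof -
  define n where "n = real (card V)"
  let ?K = "lk E a \<inter> lk E x \<inter> (V - F) \<times> (V - F)"
  note fl = finite_lk[OF tg]
  have "lk E a \<inter> lk E x \<subseteq> ?K \<union> (F \<times> V \<union> V \<times> F)" using lk_subset[OF tg, of a] by auto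
  then have "card (lk E a \<inter> lk E x) \<le> card (?K \<union> (F \<times> V \<union> V \<times> F))"
    using finV finite_subset[OF F(1) finV] fl by (intro card_mono) auto
  also have "\<dots> \<le> card ?K + (card (F \<times> V) + card (V \<times> F))"
    by (rule order_trans[OF card_Un_le add_left_mono[OF card_Un_le]])
  finally have 1: "card (lk E a \<inter> lk E x) \<le> card ?K + 2 * (card F * card V)"
    by (simp add: card_cartesian_product algebra_simps)
  have "card (lk E a \<union> lk E x) \<le> card (V \<times> V)"
    using finV lk_subset[OF tg] by (intro card_mono) auto
  then have 2: "card (lk E a) + card (lk E x) \<le> card V * card V + card (lk E a \<inter> lk E x)"
    using card_Un_Int[OF fl fl, of a x] by (simp add: card_cartesian_product)
  have "100 * card F * card V \<le> card V * card V" using F(2) by (intro mult_right_mono) auto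
  then have 3: "100 * (real (card F) * n) \<le> n\<^sup>2"
    unfolding n_def power2_eq_square by (metis mult.assoc of_nat_le_iff of_nat_mult of_nat_numeral)
  have "real (card (lk E a) + card (lk E x)) \<le> real (card V * card V + (card ?K + 2 * (card F * card V)))"
    using 1 2 by (intro of_nat_mono) linarith
  then have "real (card (lk E a)) + real (card (lk E x)) \<le> n\<^sup>2 + real (card ?K) + 2 * (real (card F) * n)"
    unfolding n_def power2_eq_square by simp
  moreover have "n\<^sup>2 \<ge> 0" by simp
  ultimately have "n\<^sup>2 \<le> 4 * real (card ?K)"
    using 3 deg[OF a] deg[OF x] unfolding n_def[symmetric] by (simp add: field_simps)
  then have "real (card V * card V) \<le> real (4 * card ?K)" unfolding n_def power2_eq_square by simp
  then show ?thesis by (rule of_nat_le_iff[THEN iffD1])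
qed

lemma pick_pair:
  assumes I: "finite I" and x: "\<And>i. i \<in> I \<Longrightarrow> x i \<in> V" and a: "a \<in> V"
    and F: "F \<subseteq> V" "100 * card F \<le> card V"
  obtains p q where "p \<in> V - F" "q \<in> V - F" "{a, p, q} \<in> E"
    "card I \<le> 4 * card {i \<in> I. {x i, p, q} \<in> E}"
proof -
  let ?K = "lk E a \<inter> (V - F) \<times> (V - F)"
  have finK: "finite ?K" using finite_lk[OF tg] by simp
  have "card ?K \<le> card (V \<times> V)" using finV by (intro card_mono) auto
  then have le: "card ?K \<le> card V * card V" by (simp add: card_cartesian_product)
  have "card V > 0" using ne finV by (simp add: card_gt_0_iff)
  then have pos: "card V * card V > 0" by simp
  have "?K \<noteq> {}"
  proof
    assume "?K = {}"
    then have "lk E a \<inter> lk E a \<inter> (V - F) \<times> (V - F) = {}" by simp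
    then show False using many_common_pairs[OF a a F] pos by simp
  qed
  moreover have "card V * card V \<le> 4 * card {k \<in> ?K. k \<in> lk E (x i)}" if "i \<in> I" for i
  proof -
    have "{k \<in> ?K. k \<in> lk E (x i)} = lk E a \<inter> lk E (x i) \<inter> (V - F) \<times> (V - F)" by auto
    then show ?thesis using many_common_pairs[OF a x[OF that] F] by simp
  qed
  ultimately obtain k where k: "k \<in> ?K" "card I \<le> 4 * card {i \<in> I. k \<in> lk E (x i)}"
    using averaging[OF I finK le, of "\<lambda>i k. k \<in> lk E (x i)"] by auto
  obtain p q where pq: "k = (p, q)" by (cases k)
  show ?thesis using k that[of p q] unfolding pq by auto
qed

text \<open>Take an edge \<open>{a, b, c}\<close> and disjoint pairs completing \<open>a\<close>,
  \<open>b\<close>, \<open>c\<close> to edges. If the same pairs also complete \<open>x\<close>,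
  \<open>y\<close>, \<open>z\<close>, then \<open>{a, b, c}\<close> becomes available as a fourth
  edge. Each pair is chosen to suit a quarter of the triples still in play, hence 64. The 7 counts
  the gadget vertices to be avoided when the last pair is chosen.\<close>

lemma gadget:
  assumes T: "T \<subseteq> V \<times> V \<times> V" and F: "F \<subseteq> V" "100 * (card F + 7) \<le> card V"
  obtains N where "matching E N" "card N = 3" "\<Union>N \<inter> F = {}"
    "card T \<le> 64 * card {(x, y, z) \<in> T. absorbs E N x y z}"
proof -
  have finF: "finite F" using F(1) finV by (rule finite_subset)
  have finT: "finite T" using T finV by (auto intro: finite_subset)
  have cardF: "100 * card (F \<union> set xs) \<le> card V" if "length xs \<le> 7" for xs
    using card_Un_le[of F "set xs"] card_length[of xs] that F(2) by simp
  have "card F < card V" using F(2) by simp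
  then obtain a where a: "a \<in> V" "a \<notin> F" using card_mono[OF finF, of V] by (metis leD subsetI)
  \<comment> \<open>With an empty index set, \<open>pick_pair\<close> just finds an edge at
    \<open>a\<close> outside \<open>F\<close>.\<close>
  obtain b c where bc: "b \<in> V - (F \<union> set [])" "c \<in> V - (F \<union> set [])" "{a, b, c} \<in> E"
    using pick_pair[of "{}" "\<lambda>_. a" a "F \<union> set []"] a(1) F(1) cardF[of "[]"] by auto
  note dabc = three_graph_edge(1-3)[OF tg bc(3)]
  let ?F1 = "F \<union> set [a, b, c]"
  have F1: "?F1 \<subseteq> V" "100 * card ?F1 \<le> card V" using F(1) a bc cardF[of "[a, b, c]"] by auto
  obtain p p' where p: "p \<in> V - ?F1" "p' \<in> V - ?F1" "{a, p, p'} \<in> E"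
    "card T \<le> 4 * card {i \<in> T. {fst i, p, p'} \<in> E}"
    by (rule pick_pair[OF finT _ a(1) F1, of fst]) (use T in auto)
  define T1 where "T1 = {i \<in> T. {fst i, p, p'} \<in> E}"
  have T1: "finite T1" "T1 \<subseteq> V \<times> V \<times> V" using finT T by (auto simp: T1_def)
  note dp = three_graph_edge(3)[OF tg p(3)]
  let ?F2 = "F \<union> set [a, b, c, p, p']"
  have F2: "?F2 \<subseteq> V" "100 * card ?F2 \<le> card V" using F(1) a bc p cardF[of "[a, b, c, p, p']"] by auto
  obtain q q' where q: "q \<in> V - ?F2" "q' \<in> V - ?F2" "{b, q, q'} \<in> E"
    "card T1 \<le> 4 * card {i \<in> T1. {fst (snd i), q, q'} \<in> E}"
    by (rule pick_pair[OF T1(1) _ _ F2, of "\<lambda>i. fst (snd i)" b]) (use T1 bc in auto)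
  define T2 where "T2 = {i \<in> T1. {fst (snd i), q, q'} \<in> E}"
  have T2: "finite T2" "T2 \<subseteq> V \<times> V \<times> V" using T1 by (auto simp: T2_def)
  note dq = three_graph_edge(3)[OF tg q(3)]
  let ?F3 = "F \<union> set [a, b, c, p, p', q, q']"
  have F3: "?F3 \<subseteq> V" "100 * card ?F3 \<le> card V" using F(1) a bc p q cardF[of "[a, b, c, p, p', q, q']"] by auto
  obtain r r' where r: "r \<in> V - ?F3" "r' \<in> V - ?F3" "{c, r, r'} \<in> E"
    "card T2 \<le> 4 * card {i \<in> T2. {snd (snd i), r, r'} \<in> E}"
    by (rule pick_pair[OF T2(1) _ _ F3, of "\<lambda>i. snd (snd i)" c]) (use T2 bc in auto)
  define T3 where "T3 = {i \<in> T2. {snd (snd i), r, r'} \<in> E}"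
  note dr = three_graph_edge(3)[OF tg r(3)]
  define N where "N = {{a, p, p'}, {b, q, q'}, {c, r, r'}}"
  have dist: "distinct [a, b, c, p, p', q, q', r, r']"
    using dabc dp dq dr p(1,2) q(1,2) r(1,2) by auto
  have N: "matching E N" "card N = 3"
    unfolding N_def by (rule matching_insert3; use p q r dist in auto)+
  have UN: "\<Union>N = {a, p, p', b, q, q', c, r, r'}" by (auto simp: N_def)
  have NF: "\<Union>N \<inter> F = {}" unfolding UN using a bc p q r by auto
  have abs: "absorbs E N x y z" if "(x, y, z) \<in> T3" for x y z
    unfolding absorbs_def
  proof (intro impI)
    assume d: "distinct [x, y, z] \<and> {x, y, z} \<inter> \<Union>N = {}"
    have e: "{x, p, p'} \<in> E" "{y, q, q'} \<in> E" "{z, r, r'} \<in> E"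
      using that unfolding T3_def T2_def T1_def by auto
    let ?N0 = "{{x, p, p'}, {y, q, q'}, {z, r, r'}}"
    have out: "x \<notin> {a, p, p', b, q, q', c, r, r'}" "y \<notin> {a, p, p', b, q, q', c, r, r'}"
      "z \<notin> {a, p, p', b, q, q', c, r, r'}" using d unfolding UN by blast+
    have N0: "matching E ?N0" "card ?N0 = 3"
      by (rule matching_insert3; use e dist d out in auto)+
    have m1: "matching E {{a, b, c}}" using bc(3) by (simp add: matching_def)
    have "\<Union>?N0 \<inter> \<Union>({{a, b, c}} - {}) = {}" using dist out by auto
    note rep = matching_replace[OF tg m1 _ N0(1) this]
    have "matching E ({{a, b, c}} - {} \<union> ?N0)" "card ({{a, b, c}} - {} \<union> ?N0) = 4"
      using rep N0(2) by simp_all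
    moreover have "\<Union>({{a, b, c}} - {} \<union> ?N0) = \<Union>N \<union> {x, y, z}" unfolding UN by auto
    ultimately show "\<exists>N'. matching E N' \<and> card N' = 4 \<and> \<Union>N' = \<Union>N \<union> {x, y, z}" by blast
  qed
  have "T3 \<subseteq> {(x, y, z) \<in> T. absorbs E N x y z}"
    using abs by (auto simp: T3_def T2_def T1_def)
  moreover have "finite {(x, y, z) \<in> T. absorbs E N x y z}" using finT by (rule rev_finite_subset) auto
  ultimately have "card T3 \<le> card {(x, y, z) \<in> T. absorbs E N x y z}" by (rule card_mono[rotated])
  then have "card T \<le> 64 * card {(x, y, z) \<in> T. absorbs E N x y z}"
    using p(4) q(4) r(4) unfolding T1_def[symmetric] T2_def[symmetric] T3_def[symmetric] by linarith
  with N NF show ?thesis by (rule that)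
qed

end

section \<open>A greedy absorbing family\<close>

context dense_graph
begin

text \<open>\<open>T\<close> holds the triples not yet served. Each new gadget is disjoint from the
  earlier ones and serves at least 1/64 of \<open>T\<close>, so \<open>T\<close> decays
  geometrically at a cost of nine vertices per gadget.\<close>

lemma absorber_sequence:
  assumes "100 * (9 * t + 7) \<le> card V"
  shows "\<exists>R T. matching E R \<and> card R = 3 * t \<and> T \<subseteq> V \<times> V \<times> V \<and>
    real (card T) \<le> (63/64) ^ t * (real (card V)) ^ 3 \<and>
    (\<forall>x\<in>V. \<forall>y\<in>V. \<forall>z\<in>V. (x, y, z) \<notin> T \<longrightarrow> (\<exists>N\<subseteq>R. card N = 3 \<and> absorbs E N x y z))"
  using assms
proof (induction t)
  case 0
  have "real (card (V \<times> V \<times> V)) \<le> (63/64) ^ 0 * (real (card V)) ^ 3"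
    by (simp add: card_cartesian_product power3_eq_cube)
  then show ?case by (intro exI[of _ "{}"] exI[of _ "V \<times> V \<times> V"]) (auto simp: matching_def)
next
  case (Suc t)
  then obtain R T where R: "matching E R" "card R = 3 * t" and T: "T \<subseteq> V \<times> V \<times> V"
    "real (card T) \<le> (63/64) ^ t * (real (card V)) ^ 3"
    and abs: "\<And>x y z. x \<in> V \<Longrightarrow> y \<in> V \<Longrightarrow> z \<in> V \<Longrightarrow> (x, y, z) \<notin> T \<Longrightarrow> \<exists>N\<subseteq>R. card N = 3 \<and> absorbs E N x y z"
    by auto
  have U: "card (\<Union>R) = 9 * t" "\<Union>R \<subseteq> V" using matching_card_Union[OF tg R(1)] R(2) by auto
  have "100 * (card (\<Union>R) + 7) \<le> card V" using Suc.prems U(1) by simp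
  then obtain N where N: "matching E N" "card N = 3" "\<Union>N \<inter> \<Union>R = {}"
    "card T \<le> 64 * card {(x, y, z) \<in> T. absorbs E N x y z}"
    by (rule gadget[OF T(1) U(2)])
  let ?A = "{(x, y, z) \<in> T. absorbs E N x y z}"
  let ?T = "T - ?A"
  have finT: "finite T" using T(1) finV by (auto intro: finite_subset)
  have "matching E (R - {} \<union> N)" "card (R - {} \<union> N) = card R - card {} + card N"
    using matching_replace[OF tg R(1) _ N(1), of "{}"] N(3) by simp_all
  then have RN: "matching E (R \<union> N)" "card (R \<union> N) = 3 * Suc t" using R(2) N(2) by simp_all
  have "?A \<subseteq> T" by auto
  then have "card ?T = card T - card ?A" "card ?A \<le> card T"
    using finT by (auto simp: card_Diff_subset finite_subset card_mono)
  then have "64 * card ?T \<le> 63 * card T" using N(4) by linarith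
  then have "real (64 * card ?T) \<le> real (63 * card T)" by (rule of_nat_mono)
  then have "real (card ?T) \<le> 63/64 * real (card T)" by simp
  also have "\<dots> \<le> 63/64 * ((63/64) ^ t * (real (card V)) ^ 3)" using T(2) by (intro mult_left_mono) auto
  finally have cT: "real (card ?T) \<le> (63/64) ^ Suc t * (real (card V)) ^ 3" by simp
  have "\<exists>N'\<subseteq>R \<union> N. card N' = 3 \<and> absorbs E N' x y z"
    if h: "x \<in> V" "y \<in> V" "z \<in> V" "(x, y, z) \<notin> ?T" for x y z
  proof (cases "(x, y, z) \<in> T")
    case True
    then have "absorbs E N x y z" using h(4) by simp
    then show ?thesis using N(2) by (intro exI[of _ N]) simp
  next
    case False
    then obtain N' where "N' \<subseteq> R" "card N' = 3" "absorbs E N' x y z" using abs[OF h(1-3)] by blast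
    then show ?thesis by (intro exI[of _ N']) auto
  qed
  then show ?case using RN T(1) cT
    by (intro exI[of _ "R \<union> N"] exI[of _ ?T]) auto
qed

end

text \<open>As 63/64 is at most the cube of 199/200, it suffices to compare cube roots, where a
  geometric sequence beats a linear one. The base of the cube bounds the number of vertices when
  \<open>t\<close> is \<open>card V div 1000000\<close>.\<close>

lemma exp_beats_cube: "\<exists>t0. \<forall>t\<ge>t0. (63/64) ^ t * (1000000 * (real t + 1)) ^ 3 < 1"
proof -
  have "(\<lambda>t. real t * (199/200 :: real) ^ t) \<longlonglongrightarrow> 0"
    using powser_times_n_limit_0[of "199/200 :: real"] by simp
  moreover have "(\<lambda>t. (199/200 :: real) ^ t) \<longlonglongrightarrow> 0" by (intro LIMSEQ_realpow_zero) auto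
  ultimately have "(\<lambda>t. real t * (199/200 :: real) ^ t + (199/200) ^ t) \<longlonglongrightarrow> 0 + 0"
    by (rule tendsto_add)
  then have "(\<lambda>t. 1000000 * (real t * (199/200 :: real) ^ t + (199/200) ^ t)) \<longlonglongrightarrow> 1000000 * (0 + 0)"
    by (rule tendsto_mult_left)
  then have "(\<lambda>t. 1000000 * (real t * (199/200 :: real) ^ t + (199/200) ^ t)) \<longlonglongrightarrow> 0" by simp
  then have "eventually (\<lambda>t. 1000000 * (real t * (199/200 :: real) ^ t + (199/200) ^ t) < 1) sequentially"
    by (rule order_tendstoD(2)) simp
  then obtain t0 where t0: "\<And>t. t \<ge> t0 \<Longrightarrow> 1000000 * (real t * (199/200 :: real) ^ t + (199/200) ^ t) < 1"
    by (auto simp: eventually_sequentially)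
  have "(63/64) ^ t * (1000000 * (real t + 1)) ^ 3 < 1" if "t \<ge> t0" for t
  proof -
    let ?s = "(199/200 :: real) ^ t * (1000000 * (real t + 1))"
    have "(63/64 :: real) ^ t \<le> ((199/200) ^ 3) ^ t" by (intro power_mono) (auto simp: power3_eq_cube)
    also have "\<dots> = ((199/200) ^ t) ^ 3" by (simp add: power_mult[symmetric] mult.commute)
    finally have "(63/64) ^ t * (1000000 * (real t + 1)) ^ 3 \<le> ((199/200) ^ t) ^ 3 * (1000000 * (real t + 1)) ^ 3"
      by (intro mult_right_mono) auto
    also have "\<dots> = ?s ^ 3" by (simp add: power_mult_distrib)
    also have "\<dots> < 1 ^ 3"
      using t0[OF that] by (intro power_strict_mono) (auto simp: algebra_simps)
    finally show ?thesis by simp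
  qed
  then show ?thesis by blast
qed

text \<open>A matching of size \<open>n/3 - 1\<close> in the complement of the absorbing family leaves three
  vertices, which one of the gadgets takes in.\<close>

theorem dense_perfect_matching:
  "\<exists>n0. \<forall>(V :: 'a set) E. three_graph V E \<longrightarrow> card V \<ge> n0 \<longrightarrow> 3 dvd card V \<longrightarrow>
     (\<forall>v\<in>V. real (card (lk E v)) \<ge> (2/3 - 1/20000) * (real (card V))\<^sup>2) \<longrightarrow>
     (\<exists>M. matching E M \<and> 3 * card M = card V)"
proof -
  obtain t0 where t0: "\<And>t. t \<ge> t0 \<Longrightarrow> (63/64) ^ t * (1000000 * (real t + 1)) ^ 3 < 1"
    using exp_beats_cube by blast
  have "\<exists>M. matching E M \<and> 3 * card M = card V"
    if tg: "three_graph V E" and large: "card V \<ge> 1000000 * (t0 + 1)" and dv: "3 dvd card V"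
      and deg: "\<forall>v\<in>V. real (card (lk E v)) \<ge> (2/3 - 1/20000) * (real (card V))\<^sup>2"
    for V :: "'a set" and E
  proof -
    interpret dense_graph V E by unfold_locales (use tg large deg in auto)
    define n where "n = card V"
    \<comment> \<open>So many gadgets reduce fewer than \<open>n^3\<close> unserved triples to none,
      yet their \<open>9 * t\<close> vertices are few compared with \<open>n\<close>.\<close>
    define t where "t = n div 1000000"
    have n: "n \<ge> 1000000" using large by (simp add: n_def)
    have t: "1000000 * t \<le> n" "n \<le> 1000000 * (t + 1)" "t \<ge> t0"
      using large unfolding t_def n_def by auto
    have "100 * (9 * t + 7) \<le> card V" using t n unfolding n_def by simp
    from absorber_sequence[OF this] obtain R T where R: "matching E R" "card R = 3 * t"
      and T: "T \<subseteq> V \<times> V \<times> V" "real (card T) \<le> (63/64) ^ t * (real (card V)) ^ 3"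
      and abs: "\<And>x y z. x \<in> V \<Longrightarrow> y \<in> V \<Longrightarrow> z \<in> V \<Longrightarrow> (x, y, z) \<notin> T \<Longrightarrow> \<exists>N\<subseteq>R. card N = 3 \<and> absorbs E N x y z"
      by auto
    have "real n \<le> real (1000000 * (t + 1))" using t(2) by (rule of_nat_mono)
    then have "(real n) ^ 3 \<le> (1000000 * (real t + 1)) ^ 3" by (intro power_mono) auto
    then have "(63/64) ^ t * (real n) ^ 3 \<le> (63/64) ^ t * (1000000 * (real t + 1)) ^ 3"
      by (intro mult_left_mono) auto
    then have "real (card T) < 1" using T(2) t0[OF t(3)] unfolding n_def by linarith
    moreover have "finite T" using T(1) finV by (auto intro: finite_subset)
    ultimately have T0: "T = {}" by simp
    define V' where "V' = V - \<Union>R"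
    define E' where "E' = {e \<in> E. e \<subseteq> V'}"
    have UR: "card (\<Union>R) = 9 * t" "\<Union>R \<subseteq> V" "finite (\<Union>R)" using matching_card_Union[OF tg R(1)] R(2) by auto
    have V': "V' \<subseteq> V" "V - V' = \<Union>R" using UR(2) unfolding V'_def by auto
    have cV': "card V' = n - 9 * t" using UR unfolding V'_def n_def by (simp add: card_Diff_subset)
    have tg': "three_graph V' E'" unfolding E'_def by (rule three_graph_induced[OF tg V'(1)])
    have dv': "3 dvd card V'" using dv unfolding cV' n_def by (intro dvd_diff_nat) auto
    have large': "card V' \<ge> 90006" using t n unfolding cV' by simp
    \<comment> \<open>Deleting the family costs at most \<open>18 * t * n\<close> in each link,
      which is below the gap between 1/20000 and 1/10000 of \<open>n^2\<close>.\<close>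
    have deg': "real (card (lk E' v)) \<ge> (2/3 - 1/10000) * (real (card V'))\<^sup>2" if v: "v \<in> V'" for v
    proof -
      have "card (lk E v) \<le> card (lk E' v) + 2 * (9 * t) * n"
        using card_lk_induced[OF tg V'(1) v] V'(2) UR(1) unfolding E'_def n_def by simp
      also have "2 * (9 * t) * n = 18 * (t * n)" by simp
      finally have 1: "real (card (lk E v)) \<le> real (card (lk E' v)) + 18 * (real t * real n)"
        by (metis of_nat_add of_nat_le_iff of_nat_mult of_nat_numeral)
      have "1000000 * t * n \<le> n * n" using t(1) by (intro mult_right_mono) auto
      then have "real (1000000 * t * n) \<le> real (n * n)" by (rule of_nat_mono)
      then have 2: "1000000 * (real t * real n) \<le> (real n)\<^sup>2" by (simp add: power2_eq_square)
      have 3: "real (card (lk E v)) \<ge> (2/3 - 1/20000) * (real n)\<^sup>2" using deg v V' unfolding n_def by auto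
      have "card V' \<le> n" unfolding cV' by simp
      then have "(real (card V'))\<^sup>2 \<le> (real n)\<^sup>2" by (intro power_mono) auto
      then have 4: "(2/3 - 1/10000) * (real (card V'))\<^sup>2 \<le> (2/3 - 1/10000) * (real n)\<^sup>2"
        by (intro mult_left_mono) auto
      have "(real n)\<^sup>2 \<ge> 0" by simp
      with 1 2 3 have "(2/3 - 1/10000) * (real n)\<^sup>2 \<le> real (card (lk E' v))" by (simp add: field_simps)
      with 4 show ?thesis by (rule order_trans)
    qed
    obtain M where M: "matching E' M" "card M = card V' div 3 - 1"
      using near_perfect_matching[OF tg' dv' large' deg'] by blast
    note UM = matching_card_Union[OF tg' M(1)]
    have "card (V' - \<Union>M) = 3"
      using UM M(2) dv' large' by (auto simp: card_Diff_subset)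
    then obtain x y z where xyz: "V' - \<Union>M = {x, y, z}" "distinct [x, y, z]" by (auto simp: card_3_iff)
    have mem: "x \<in> V" "y \<in> V" "z \<in> V" "{x, y, z} \<inter> \<Union>R = {}" "{x, y, z} \<inter> \<Union>M = {}"
      using xyz(1) V'(1) unfolding V'_def by blast+
    obtain N where N: "N \<subseteq> R" "card N = 3" "absorbs E N x y z"
      using abs[OF mem(1-3)] T0 by auto
    have "{x, y, z} \<inter> \<Union>N = {}" using mem(4) N(1) by blast
    then obtain N' where N': "matching E N'" "card N' = 4" "\<Union>N' = \<Union>N \<union> {x, y, z}"
      using N(3) xyz(2) unfolding absorbs_def by auto
    have ME: "matching E M" using M(1) unfolding matching_def E'_def by auto
    have MR: "\<Union>M \<inter> \<Union>R = {}" using UM(2) unfolding V'_def by blast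
    have "matching E (R - {} \<union> M)" "card (R - {} \<union> M) = card R - card {} + card M"
      using matching_replace[OF tg R(1) _ ME, of "{}"] MR by auto
    then have RM: "matching E (R \<union> M)" "card (R \<union> M) = 3 * t + card M" using R(2) by simp_all
    have NM: "\<Union>N \<inter> \<Union>(R \<union> M - N) = {}"
    proof -
      have "e \<inter> f = {}" if "e \<in> N" "f \<in> R \<union> M - N" for e f
        using RM(1) that N(1) disjointD[of "R \<union> M" e f] unfolding matching_def by auto
      then show ?thesis by blast
    qed
    have "\<Union>N' \<inter> \<Union>(R \<union> M - N) = {}"
      unfolding N'(3) using NM mem(4,5) by blast
    note rep = matching_replace[OF tg RM(1) _ N'(1) this]
    have "N \<subseteq> R \<union> M" using N(1) by blast
    note rep = rep[OF this]
    have t9: "9 * t \<le> n" using t(1) by simp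
    have "card (R \<union> M) \<ge> 3" using card_mono[OF matching_finite[OF tg RM(1)] \<open>N \<subseteq> R \<union> M\<close>] N(2) by simp
    then have "card (R \<union> M - N \<union> N') = 3 * t + card V' div 3"
      using rep(2) RM(2) M(2) N(2) N'(2) large' by simp
    then have "3 * card (R \<union> M - N \<union> N') = card V"
      using dv' t9 cV' unfolding n_def by auto
    with rep(1) show ?thesis by blast
  qed
  then show ?thesis by blast
qed

section \<open>The exceptional set\<close>

lemma card_meeting_le:
  assumes "disjoint M" "finite Z"
  shows "card {e \<in> M. e \<inter> Z \<noteq> {}} \<le> card Z"
proof -
  define f where "f e = (SOME x. x \<in> e \<inter> Z)" for e
  have f: "f e \<in> e \<inter> Z" if "e \<inter> Z \<noteq> {}" for e
    unfolding f_def using that by (meson ex_in_conv someI_ex)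
  have "inj_on f {e \<in> M. e \<inter> Z \<noteq> {}}"
  proof (rule inj_onI, rule ccontr)
    fix a b assume ab: "a \<in> {e \<in> M. e \<inter> Z \<noteq> {}}" "b \<in> {e \<in> M. e \<inter> Z \<noteq> {}}" "f a = f b" "a \<noteq> b"
    then have "f a \<in> a" "f a \<in> b" using f[of a] f[of b] by auto
    moreover have "a \<inter> b = {}" using ab disjointD[OF assms(1), of a b] by simp
    ultimately show False by auto
  qed
  moreover have "f ` {e \<in> M. e \<inter> Z \<noteq> {}} \<subseteq> Z" using f by auto
  ultimately show ?thesis using assms(2) by (rule card_inj_on_le)
qed

lemma card_meeting_ge:
  assumes "finite M" "\<And>e. e \<in> M \<Longrightarrow> card (e \<inter> W) \<le> 1"
  shows "card (W \<inter> \<Union>M) \<le> card {e \<in> M. e \<inter> W \<noteq> {}}"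
proof -
  let ?A = "{e \<in> M. e \<inter> W \<noteq> {}}"
  have eq: "W \<inter> \<Union>M = (\<Union>e\<in>?A. e \<inter> W)" by auto
  have "card (W \<inter> \<Union>M) \<le> (\<Sum>e\<in>?A. card (e \<inter> W))"
    unfolding eq using assms(1) by (intro card_UN_le) auto
  also have "\<dots> \<le> (\<Sum>e\<in>?A. 1)" using assms(2) by (intro sum_mono) auto
  finally show ?thesis by simp
qed

text \<open>Choose greedily: before each choice fewer than \<open>card W\<close> values are
  taken.\<close>

lemma injective_choice:
  assumes "finite W" "\<And>w. w \<in> W \<Longrightarrow> card W \<le> card (A w)"
  shows "\<exists>r. inj_on r W \<and> (\<forall>w\<in>W. r w \<in> A w)"
proof -
  have "\<exists>r. inj_on r X \<and> (\<forall>w\<in>X. r w \<in> A w)" if "X \<subseteq> W" for X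
    using finite_subset[OF that assms(1)] that
  proof (induction X rule: finite_induct)
    case empty
    then show ?case by simp
  next
    case (insert x X)
    then obtain r where r: "inj_on r X" "\<forall>w\<in>X. r w \<in> A w" by auto
    have "card (r ` X) \<le> card X" using insert.hyps(1) by (rule card_image_le)
    also have "card X < card (insert x X)" using insert.hyps by simp
    also have "\<dots> \<le> card W" using insert.prems assms(1) by (rule card_mono[rotated])
    also have "\<dots> \<le> card (A x)" using insert.prems assms(2) by simp
    finally have "\<not> A x \<subseteq> r ` X" using card_mono[of "r ` X" "A x"] insert.hyps(1) by auto
    then obtain y where y: "y \<in> A x" "y \<notin> r ` X" by auto
    have "inj_on (r(x := y)) (insert x X)"
      using r(1) y(2) insert.hyps(2) by (auto simp: inj_on_def)
    moreover have "\<forall>w\<in>insert x X. (r(x := y)) w \<in> A w" using r(2) y(1) by auto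
    ultimately show ?case by blast
  qed
  then show ?thesis by simp
qed

lemma injective_extend:
  assumes "finite Y" "finite B" "inj_on r W" "r ` W \<subseteq> Y" "W \<inter> B = {}" "card (r ` W) + card B \<le> card Y"
  obtains r' where "inj_on r' (W \<union> B)" "r' ` (W \<union> B) \<subseteq> Y" "\<And>w. w \<in> W \<Longrightarrow> r' w = r w"
proof -
  have "finite (r ` W)" using assms(4,1) by (rule finite_subset)
  then have "card B \<le> card (Y - r ` W)" using assms(1,4,6) by (simp add: card_Diff_subset)
  then obtain g where g: "g ` B \<subseteq> Y - r ` W" "inj_on g B" using card_le_inj[of B "Y - r ` W"] assms(1,2) by auto
  let ?r = "\<lambda>z. if z \<in> W then r z else g z"
  have gB: "?r z = g z" if "z \<in> B" for z using that assms(5) by auto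
  have "inj_on ?r W" using assms(3) by (simp add: inj_on_def)
  moreover have "inj_on ?r B" using g(2) gB by (simp add: inj_on_def)
  moreover have im: "?r ` W = r ` W" "?r ` B = g ` B" using gB by auto
  ultimately have "inj_on ?r (W \<union> B)" unfolding inj_on_Un using g(1) by auto
  moreover have "?r ` (W \<union> B) \<subseteq> Y" unfolding image_Un im using g(1) assms(4) by auto
  ultimately show ?thesis by (rule that) simp
qed

text \<open>At each stage at most \<open>3 * card W\<close> vertices are covered, and they block at
  most \<open>6 * card W * card V\<close> pairs of a link. A new edge covers no second vertex of
  \<open>W\<close>, which preserves the invariant \<open>\<Union>M \<inter> W = X\<close>.\<close>

lemma greedy_cover:
  assumes tg: "three_graph V E" and W: "W \<subseteq> V" and leg: "\<And>e. e \<in> E \<Longrightarrow> card (e \<inter> W) \<le> 1"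
    and deg: "\<And>w. w \<in> W \<Longrightarrow> 6 * card W * card V < card (lk E w)"
  shows "\<exists>M. matching E M \<and> card M = card W \<and> W \<subseteq> \<Union>M"
proof -
  have finV: "finite V" using tg by (simp add: three_graph_def)
  have finW: "finite W" using W finV by (rule finite_subset)
  have "\<exists>M. matching E M \<and> card M = card X \<and> \<Union>M \<inter> W = X" if "X \<subseteq> W" for X
    using finite_subset[OF that finW] that
  proof (induction X rule: finite_induct)
    case empty
    then show ?case by (intro exI[of _ "{}"]) (simp add: matching_def)
  next
    case (insert w X)
    then obtain M where M: "matching E M" "card M = card X" "\<Union>M \<inter> W = X" by auto
    note U = matching_card_Union[OF tg M(1)]
    have wW: "w \<in> W" using insert.prems by simp
    have "card X \<le> card W" using insert.prems finW by (intro card_mono) auto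
    then have "card (\<Union>M) \<le> 3 * card W" using U(1) M(2) by simp
    then have "card (\<Union>M) * card V \<le> 3 * card W * card V" by (rule mult_right_mono) simp
    moreover have "card (\<Union>M \<times> V \<union> V \<times> \<Union>M) \<le> card (\<Union>M \<times> V) + card (V \<times> \<Union>M)" by (rule card_Un_le)
    ultimately have "card (\<Union>M \<times> V \<union> V \<times> \<Union>M) \<le> 6 * card W * card V"
      unfolding card_cartesian_product mult.commute[of "card V" "card (\<Union>M)"] by linarith
    with deg[OF wW] have lt: "card (\<Union>M \<times> V \<union> V \<times> \<Union>M) < card (lk E w)" by simp
    have "\<not> lk E w \<subseteq> \<Union>M \<times> V \<union> V \<times> \<Union>M"
    proof
      assume "lk E w \<subseteq> \<Union>M \<times> V \<union> V \<times> \<Union>M"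
      moreover have "finite (\<Union>M \<times> V \<union> V \<times> \<Union>M)" using U(3) finV by simp
      ultimately have "card (lk E w) \<le> card (\<Union>M \<times> V \<union> V \<times> \<Union>M)" by (rule card_mono[rotated])
      with lt show False by simp
    qed
    then obtain x where x: "x \<in> lk E w" "x \<notin> \<Union>M \<times> V \<union> V \<times> \<Union>M" by blast
    obtain p q where "x = (p, q)" by (cases x)
    with x have pq: "(p, q) \<in> lk E w" "(p, q) \<notin> \<Union>M \<times> V \<union> V \<times> \<Union>M" by simp_all
    have e: "{w, p, q} \<in> E" using pq(1) by simp
    note d = three_graph_edge[OF tg e]
    have pqM: "p \<notin> \<Union>M" "q \<notin> \<Union>M" using pq(2) d by auto
    have wM: "w \<notin> \<Union>M" using M(3) wW insert.hyps(2) by auto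
    have pqW: "{w, p, q} \<inter> W = {w}"
    proof -
      have "{w} = {w, p, q} \<inter> W"
        using leg[OF e] wW by (intro card_seteq) auto
      then show ?thesis by simp
    qed
    have m1: "matching E {{w, p, q}}" using e by (simp add: matching_def)
    have "\<Union>{{w, p, q}} \<inter> \<Union>(M - {}) = {}" using wM pqM by auto
    note rep = matching_replace[OF tg M(1) _ m1 this]
    have "matching E (M \<union> {{w, p, q}})" "card (M \<union> {{w, p, q}}) = card (insert w X)"
      using rep M(2) insert.hyps by simp_all
    moreover have "\<Union>(M \<union> {{w, p, q}}) \<inter> W = insert w X" using pqW M(3) by auto
    ultimately show ?case by (intro exI[of _ "M \<union> {{w, p, q}}"]) simp
  qed
  from this[of W] show ?thesis by auto
qed

text \<open>All but at most one vertex of \<open>W\<close> are covered, and by different edges. The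
  pairs counted here are those to which \<open>block_sum_le17\<close> applies.\<close>

lemma (in stuck_matching) card_pairs_meeting:
  assumes "\<And>e. e \<in> E \<Longrightarrow> card (e \<inter> W) \<le> 1" "finite W" "card W \<le> Suc (card (W \<inter> \<Union>M))"
  shows "(card W - 1) * (card W - 2)
    \<le> card {(a, b). a \<in> M \<and> b \<in> M \<and> a \<noteq> b \<and> a \<inter> W \<noteq> {} \<and> b \<inter> W \<noteq> {}}"
proof -
  let ?A = "{e \<in> M. e \<inter> W \<noteq> {}}"
  have "M \<subseteq> E" using M by (simp add: matching_def)
  then have "card (W \<inter> \<Union>M) \<le> card ?A" using finM assms(1) by (intro card_meeting_ge) auto
  then have le: "card W - 1 \<le> card ?A" using assms(3) by linarith
  have finA: "finite ?A" using finM by simp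
  have "{(a, b). a \<in> M \<and> b \<in> M \<and> a \<noteq> b \<and> a \<inter> W \<noteq> {} \<and> b \<inter> W \<noteq> {}} = (SIGMA a:?A. ?A - {a})" by auto
  moreover have "card (SIGMA a:?A. ?A - {a}) = (\<Sum>a\<in>?A. card (?A - {a}))" using finA by (intro card_SigmaI) auto
  moreover have "\<dots> = (\<Sum>a\<in>?A. card ?A - 1)" using finA by (intro sum.cong refl) (rule card_Diff_singleton)
  ultimately have "card {(a, b). a \<in> M \<and> b \<in> M \<and> a \<noteq> b \<and> a \<inter> W \<noteq> {} \<and> b \<inter> W \<noteq> {}} = card ?A * (card ?A - 1)"
    by simp
  moreover have "(card W - 1) * (card W - 2) \<le> card ?A * (card ?A - 1)" using le by (intro mult_mono) auto
  ultimately show ?thesis by simp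
qed

text \<open>In an edge-maximal counterexample among hypergraphs whose edges meet \<open>W\<close> at
  most once, every admissible triple of large degree sum is an edge. For triples meeting
  \<open>W\<close> the required sum is smaller by more than the loss \<open>\<epsilon>\<close> in
  the hypotheses. Stars centred at \<open>W\<close> and at vertices of high degree then give the
  matching.\<close>

lemma perfect_matching_many_exceptional:
  fixes V :: "'a set"
  defines "\<epsilon> \<equiv> 1 / 10 ^ 12 :: real"
  assumes dense: "\<And>E'. three_graph V E' \<Longrightarrow>
       (\<forall>v\<in>V. real (card (lk E' v)) \<ge> (2/3 - 1/20000) * (real (card V))\<^sup>2) \<Longrightarrow>
       \<exists>M. matching E' M \<and> 3 * card M = card V"
    and tg: "three_graph V E" and dv: "3 dvd card V" and large: "card V \<ge> 10 ^ 14"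
    and W: "W \<subseteq> V" "card V \<le> 200000 * card W" "3 * card W \<le> card V"
    and leg: "\<And>e. e \<in> E \<Longrightarrow> card (e \<inter> W) \<le> 1"
    and degU: "\<And>u. u \<in> V - W \<Longrightarrow> real (card (lk E u)) \<ge> (2/3 - \<epsilon>) * (real (card V))\<^sup>2"
    and adj: "\<And>u v. hadjacent E u v \<Longrightarrow>
       real (card (lk E u)) + real (card (lk E v)) \<ge> (4/3 - 2 * \<epsilon>) * (real (card V))\<^sup>2"
    and niso: "\<And>w. w \<in> W \<Longrightarrow> lk E w \<noteq> {}"
  shows "\<exists>M. matching E M \<and> card M = card V div 3"
proof (rule ccontr)
  assume no: "\<nexists>M. matching E M \<and> card M = card V div 3"
  define n where "n = real (card V)"
  define C where "C = {e. e \<subseteq> V \<and> card e = 3 \<and> card (e \<inter> W) \<le> 1}"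
  have finV: "finite V" using tg by (simp add: three_graph_def)
  have finW: "finite W" using W(1) finV by (rule finite_subset)
  have tgC: "three_graph V C" using finV by (auto simp: three_graph_def C_def)
  have EC: "E \<subseteq> C" using tg leg by (auto simp: three_graph_def C_def)
  obtain F where F: "E \<subseteq> F" "F \<subseteq> C" and noF: "\<nexists>M. matching F M \<and> card M = card V div 3"
    and sat: "\<And>e. e \<in> C - F \<Longrightarrow> \<exists>M. matching F M \<and> Suc (card M) = card V div 3 \<and> e \<inter> \<Union>M = {}"
    by (rule saturate[OF tgC EC no]) blast
  have tgF: "three_graph V F" using F(2) tgC unfolding three_graph_def by blast
  have legF: "card (e \<inter> W) \<le> 1" if "e \<in> F" for e using F(2) that unfolding C_def by blast
  define d where "d v = real (card (lk F v))" for v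
  have dE: "real (card (lk E v)) \<le> d v" for v
    unfolding d_def using lk_mono[OF F(1), of v] finite_lk[OF tgF] by (simp add: card_mono)
  define k where "k = card V div 3"
  have k: "card V = 3 * k" using dv by (simp add: k_def)
  have n1: "n \<ge> 10 ^ 14" using large unfolding n_def by simp
  then have nn: "10 ^ 14 * n \<le> n\<^sup>2" unfolding power2_eq_square by (intro mult_right_mono) auto
  have npos: "n\<^sup>2 > 0" using n1 by simp

  \<comment> \<open>The matching belonging to a missing triple leaves exactly that triple uncovered.
    The main term is \<open>18 * (k * k) = 2 * n^2\<close>, and the rest adds up to
    \<open>21 * n\<close>, at most \<open>\<epsilon> / 2 * n^2\<close> for
    \<open>n \<ge> 10 ^ 14\<close>.\<close>
  have sum_le: "d x + d y + d z \<le> (2 + \<epsilon> / 2) * n\<^sup>2 \<and> (x \<in> W \<longrightarrow> d x + d y + d z \<le> (2 - 10 * \<epsilon>) * n\<^sup>2)"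
    if xyz: "{x, y, z} \<in> C - F" for x y z
  proof -
    obtain M where hM: "matching F M" "Suc (card M) = k" "{x, y, z} \<inter> \<Union>M = {}"
      using sat[OF xyz] unfolding k_def by auto
    interpret stuck_matching V F M
      by unfold_locales (use tgF hM noF in \<open>auto simp: k_def\<close>)
    note U = matching_card_Union[OF tgF hM(1)]
    have cL: "card (V - \<Union>M) = 3" using U k hM(2) finV by (simp add: card_Diff_subset)
    have dist: "distinct [x, y, z]" using three_graph_edge(1-3)[OF tgC, of x y z] xyz by auto
    have out: "x \<notin> \<Union>M" "y \<notin> \<Union>M" "z \<notin> \<Union>M" using hM(3) by auto
    have mk: "card M * card M \<le> k * k" "card M \<le> k" using hM(2) by (auto intro: mult_mono)
    have kk: "9 * real (k * k) = n\<^sup>2" "3 * real k = n" using k unfolding n_def power2_eq_square by auto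
    have gen: "d x + d y + d z + real (card P) \<le> 2 * n\<^sup>2 + 21 * n"
      if "P \<subseteq> M \<times> M" "\<And>a b. (a, b) \<in> P \<Longrightarrow> a \<noteq> b \<and> blk F x a b + blk F y a b + blk F z a b \<le> 17" for P
    proof -
      have "card (lk F x) + card (lk F y) + card (lk F z) + card P \<le> 18 * card M * card M + 9 * card M + 6 * 3 * card V"
        using degree_sum3[OF dist out that] unfolding cL .
      also have "\<dots> \<le> 18 * (k * k) + 9 * k + 18 * card V" using mk by simp
      finally have "real (card (lk F x) + card (lk F y) + card (lk F z) + card P) \<le> real (18 * (k * k) + 9 * k + 18 * card V)"
        by (rule of_nat_mono)
      then have "d x + d y + d z + real (card P) \<le> 18 * real (k * k) + 9 * real k + 18 * n"
        unfolding d_def n_def by simp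
      then show ?thesis using kk by linarith
    qed
    have "d x + d y + d z \<le> 2 * n\<^sup>2 + 21 * n" using gen[of "{}"] by simp
    moreover have "21 * n \<le> \<epsilon> / 2 * n\<^sup>2" using nn n1 unfolding \<epsilon>_def by simp
    ultimately have "d x + d y + d z \<le> (2 + \<epsilon> / 2) * n\<^sup>2" by (simp add: algebra_simps)
    \<comment> \<open>Each pair of matching edges meeting \<open>W\<close> saves one. With
      \<open>card W\<close> at least \<open>n / 200000\<close> this amounts, up to linear terms, to
      \<open>n^2 / 40000000000\<close>, which exceeds \<open>10 * \<epsilon> * n^2\<close>.\<close>
    moreover have "d x + d y + d z \<le> (2 - 10 * \<epsilon>) * n\<^sup>2" if xW: "x \<in> W"
    proof -
      let ?P = "{(a, b). a \<in> M \<and> b \<in> M \<and> a \<noteq> b \<and> a \<inter> W \<noteq> {} \<and> b \<inter> W \<noteq> {}}"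
      have P17: "a \<noteq> b \<and> blk F x a b + blk F y a b + blk F z a b \<le> 17" if "(a, b) \<in> ?P" for a b
        using that block_sum_le17[OF _ _ _ dist out xW _ _ legF, of a b] by auto
      have "?P \<subseteq> M \<times> M" by auto
      from gen[OF this P17] have g: "d x + d y + d z + real (card ?P) \<le> 2 * n\<^sup>2 + 21 * n" by simp
      have "{x, y, z} \<inter> W = {x}"
      proof -
        have "card ({x, y, z} \<inter> W) \<le> 1" using xyz unfolding C_def by blast
        then have "{x} = {x, y, z} \<inter> W" using xW by (intro card_seteq) auto
        then show ?thesis by simp
      qed
      moreover have "V - \<Union>M = {x, y, z}"
      proof -
        have "{x, y, z} \<subseteq> V - \<Union>M" using xyz out unfolding C_def by auto
        then have "{x, y, z} = V - \<Union>M" using dist cL finV by (intro card_subset_eq) auto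
        then show ?thesis by simp
      qed
      ultimately have "W \<subseteq> insert x (W \<inter> \<Union>M)" using W(1) by auto
      then have "card W \<le> card (insert x (W \<inter> \<Union>M))" using finW by (intro card_mono) auto
      also have "\<dots> \<le> Suc (card (W \<inter> \<Union>M))" using finW by (simp add: card_insert_if)
      finally have "(card W - 1) * (card W - 2) \<le> card ?P"
        by (intro card_pairs_meeting legF finW)
      then have "real ((card W - 1) * (card W - 2)) \<le> real (card ?P)" by (rule of_nat_mono)
      moreover have W2: "card W \<ge> 2" using W(2) large by simp
      ultimately have "(real (card W) - 1) * (real (card W) - 2) \<le> real (card ?P)"
        by (simp add: of_nat_diff)
      moreover have "(real (card W) - 1) * (real (card W) - 2) \<ge> (real (card W))\<^sup>2 - 3 * real (card W)"
        by (simp add: algebra_simps power2_eq_square)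
      moreover have "3 * real (card W) \<le> n" using W(3) unfolding n_def by simp
      moreover have "n\<^sup>2 \<le> (200000 * real (card W))\<^sup>2" using W(2) unfolding n_def by (intro power_mono) auto
      then have "n\<^sup>2 / 40000000000 \<le> (real (card W))\<^sup>2" by (simp add: power_mult_distrib)
      ultimately have "d x + d y + d z + n\<^sup>2 / 40000000000 \<le> 2 * n\<^sup>2 + 22 * n" using g by linarith
      moreover have "22 * n + 10 * \<epsilon> * n\<^sup>2 \<le> n\<^sup>2 / 40000000000" using nn n1 unfolding \<epsilon>_def by simp
      ultimately show ?thesis by (simp add: algebra_simps)
    qed
    ultimately show ?thesis by simp
  qed

  define U where "U = V - W"
  have dU: "d u \<ge> (2/3 - \<epsilon>) * n\<^sup>2" if "u \<in> U" for u
    using degU[of u] dE[of u] that unfolding U_def n_def by linarith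
  have legal: "{x, y, z} \<in> C" if "x \<in> V" "y \<in> U" "z \<in> U" "distinct [x, y, z]" for x y z
  proof -
    have "{x, y, z} \<inter> W \<subseteq> {x}" using that unfolding U_def by auto
    then have "card ({x, y, z} \<inter> W) \<le> 1" using card_mono[of "{x}" "{x, y, z} \<inter> W"] by simp
    then show ?thesis using that unfolding C_def U_def by (auto simp: card3_iff)
  qed
  have eps: "\<epsilon> > 0" by (simp add: \<epsilon>_def)
  have en: "\<epsilon> * n\<^sup>2 > 0" using eps npos by simp
  have edge_sum: "{x, y, z} \<in> F"
    if "x \<in> V" "y \<in> U" "z \<in> U" "distinct [x, y, z]"
      "d x + d y + d z > (2 + \<epsilon> / 2) * n\<^sup>2 \<or> x \<in> W \<and> d x + d y + d z > (2 - 10 * \<epsilon>) * n\<^sup>2" for x y z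
    using sum_le[of x y z] legal[OF that(1-4)] that(5) by fastforce
  \<comment> \<open>Adjacency is taken in \<open>E\<close>, where the degree sum hypothesis holds.
    The sum is at least \<open>(2 - 3 * \<epsilon>) * n^2\<close>, which suffices because the triple
    meets \<open>W\<close>.\<close>
  have edge_adj: "{w, u, u'} \<in> F" if "w \<in> W" "hadjacent E w u" "u \<in> U" "u' \<in> U" "u \<noteq> u'" for w u u'
  proof (rule edge_sum)
    have "(4/3 - 2 * \<epsilon>) * n\<^sup>2 \<le> d w + d u" using adj[OF that(2)] dE[of w] dE[of u] unfolding n_def by linarith
    then have "d w + d u + d u' > (2 - 10 * \<epsilon>) * n\<^sup>2" using dU[OF that(4)] en by (simp add: algebra_simps)
    then show "d w + d u + d u' > (2 + \<epsilon> / 2) * n\<^sup>2 \<or> w \<in> W \<and> d w + d u + d u' > (2 - 10 * \<epsilon>) * n\<^sup>2"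
      using that(1) by simp
  qed (use that W(1) in \<open>auto simp: U_def\<close>)
  \<comment> \<open>The surplus \<open>3 * \<epsilon>\<close> covers the deficits of two vertices of
    \<open>U\<close> with \<open>\<epsilon>\<close> to spare, so a vertex of \<open>B\<close> forms
    an edge with every pair from \<open>U\<close>.\<close>
  define B where "B = {u \<in> U. d u \<ge> (2/3 + 3 * \<epsilon>) * n\<^sup>2}"
  have edge_B: "{b, u, u'} \<in> F" if "b \<in> B" "u \<in> U" "u' \<in> U" "distinct [b, u, u']" for b u u'
  proof (rule edge_sum)
    have "d b \<ge> (2/3 + 3 * \<epsilon>) * n\<^sup>2" using that(1) by (simp add: B_def)
    then have "d b + d u + d u' > (2 + \<epsilon> / 2) * n\<^sup>2"
      using dU[OF that(2)] dU[OF that(3)] en by (simp add: algebra_simps)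
    then show "d b + d u + d u' > (2 + \<epsilon> / 2) * n\<^sup>2 \<or> b \<in> W \<and> d b + d u + d u' > (2 - 10 * \<epsilon>) * n\<^sup>2" by simp
  qed (use that in \<open>auto simp: U_def B_def\<close>)
  have BU: "B \<subseteq> U" by (auto simp: B_def)
  have UV: "U \<subseteq> V" "U \<inter> W = {}" by (auto simp: U_def)
  have finU: "finite U" using UV(1) finV by (rule finite_subset)
  have finB: "finite B" using BU finU by (rule finite_subset)
  define N where "N w = {u. hadjacent E w u}" for w
  have NU: "N w \<subseteq> U" if "w \<in> W" for w
  proof
    fix u assume "u \<in> N w"
    then obtain e where e: "e \<in> E" "w \<in> e" "u \<in> e" "w \<noteq> u" by (auto simp: N_def hadjacent_def)
    have "u \<notin> W"
    proof
      assume "u \<in> W"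
      moreover have "finite (e \<inter> W)" using finW by simp
      ultimately have "card {w, u} \<le> card (e \<inter> W)" using e that by (intro card_mono) auto
      then show False using leg[OF e(1)] e(4) by simp
    qed
    moreover have "u \<in> V" using e tg by (auto simp: three_graph_def)
    ultimately show "u \<in> U" by (simp add: U_def)
  qed
  have lkN: "lk E w \<subseteq> N w \<times> N w" for w
  proof
    fix x assume x: "x \<in> lk E w"
    obtain p q where pq: "x = (p, q)" by (cases x)
    then have e: "{w, p, q} \<in> E" using x by simp
    note three_graph_edge[OF tg e]
    then show "x \<in> N w \<times> N w" using e unfolding pq N_def hadjacent_def by auto
  qed
  \<comment> \<open>The link of a neighbour has at most \<open>n^2\<close> pairs, so the link of
    \<open>w\<close> has at least \<open>n^2 / 4\<close>, all of them inside
    \<open>N w \<times> N w\<close>.\<close>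
  have cN: "card V \<le> 2 * card (N w)" if w: "w \<in> W" for w
  proof -
    obtain x where "x \<in> lk E w" using niso[OF w] by auto
    then have "N w \<noteq> {}" using lkN[of w] by auto
    then obtain u where u: "hadjacent E w u" by (auto simp: N_def)
    have "real (card (lk E u)) \<le> real (card V * card V)" using card_lk_le[OF tg, of u] by (rule of_nat_mono)
    then have "real (card (lk E u)) \<le> n\<^sup>2" by (simp add: n_def power2_eq_square)
    then have "n\<^sup>2 / 4 \<le> real (card (lk E w))" using adj[OF u] npos unfolding n_def[symmetric] \<epsilon>_def
      by (simp add: algebra_simps)
    moreover have "finite (N w \<times> N w)" using NU[OF w] finU by (simp add: finite_subset)
    then have "card (lk E w) \<le> card (N w \<times> N w)" using lkN by (rule card_mono)
    then have "real (card (lk E w)) \<le> real (card (N w) * card (N w))"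
      unfolding card_cartesian_product by (rule of_nat_mono)
    ultimately have "n\<^sup>2 \<le> (2 * real (card (N w)))\<^sup>2" by (simp add: power2_eq_square)
    then have "n \<le> 2 * real (card (N w))" by (rule power2_le_imp_le) simp
    then show ?thesis unfolding n_def by linarith
  qed

  show False
  proof (cases "k \<le> card B + card W")
    \<comment> \<open>There are \<open>k\<close> centres available. The first leaf of
      \<open>w \<in> W\<close> must come from \<open>N w\<close>, after which any second leaf in
      \<open>U\<close> works. As \<open>N w - B1\<close> has at least
      \<open>3 * k / 2 - (k - card W)\<close> elements, the first leaves can be chosen
      injectively.\<close>
    case True
    then have "k - card W \<le> card B" by simp
    then obtain B1 where B1: "B1 \<subseteq> B" "card B1 = k - card W" "finite B1" by (rule obtain_subset_with_card_n)
    have kW: "card W \<le> k" using W(3) k by simp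
    have WB1: "W \<inter> B1 = {}" using B1(1) BU UV(2) by auto
    define Y where "Y = V - (W \<union> B1)"
    have cZ: "card (W \<union> B1) = k" using WB1 finW B1(2,3) kW by (simp add: card_Un_disjoint)
    have ZV: "W \<union> B1 \<subseteq> V" using W(1) B1(1) BU UV(1) by auto
    have cY: "card Y = 2 * k" unfolding Y_def using ZV cZ k finW B1(3) by (simp add: card_Diff_subset)
    have finY: "finite Y" using finV by (simp add: Y_def)
    have YU: "Y \<subseteq> U" by (auto simp: Y_def U_def)
    have "card W \<le> card (N w - B1)" if "w \<in> W" for w
    proof -
      have "card (N w) - card B1 \<le> card (N w - B1)" by (rule diff_card_le_card_Diff[OF B1(3)])
      then show ?thesis using cN[OF that] k B1(2) kW by linarith
    qed
    then obtain r where r: "inj_on r W" "\<forall>w\<in>W. r w \<in> N w - B1"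
      using injective_choice[OF finW, of "\<lambda>w. N w - B1"] by blast
    have rY: "r ` W \<subseteq> Y" using r(2) NU unfolding Y_def U_def by blast
    have "card (r ` W) + card B1 \<le> card Y" using card_image[OF r(1)] B1(2) kW cY by simp
    then obtain r' where r': "inj_on r' (W \<union> B1)" "r' ` (W \<union> B1) \<subseteq> Y" "\<And>w. w \<in> W \<Longrightarrow> r' w = r w"
      by (rule injective_extend[OF finY B1(3) r(1) rY WB1]) blast
    have "(W \<union> B1) \<inter> Y = {}" by (auto simp: Y_def)
    moreover have "card Y = 2 * card (W \<union> B1)" using cY cZ by simp
    moreover have "{z, r' z, y} \<in> F" if z: "z \<in> W \<union> B1" and y: "y \<in> Y - r' ` (W \<union> B1)" for z y
    proof -
      have yU: "y \<in> U" "r' z \<in> U" "r' z \<noteq> y" using y z r'(2) YU by auto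
      show ?thesis
      proof (cases "z \<in> W")
        case True
        then have "hadjacent E z (r' z)" using r(2) r'(3) by (auto simp: N_def)
        then show ?thesis using edge_adj[OF True _ yU(2,1,3)] by simp
      next
        case False
        then have "z \<in> B" using z B1(1) by auto
        moreover have "z \<notin> Y" using z by (simp add: Y_def)
        then have "distinct [z, r' z, y]" using y z r'(2) yU(3) by auto
        ultimately show ?thesis using edge_B yU by simp
      qed
    qed
    ultimately obtain M where "matching F M" "card M = card (W \<union> B1)"
      by (rule star_matching_extend[OF _ finY _ _ r'(1,2), rotated]) (use finW B1(3) in auto)
    then show False using noF cZ unfolding k_def by auto
  next
    \<comment> \<open>Now \<open>B\<close> is too small to contain \<open>N w\<close>, so
      \<open>w\<close> has a neighbour outside \<open>B\<close>, and the degree sum forces the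
      degree of \<open>w\<close> itself close to 2/3. Hence every vertex of \<open>Z\<close> forms
      an edge with every pair from \<open>U\<close>.\<close>
    case False
    define Z where "Z = W \<union> B"
    have WB: "W \<inter> B = {}" using BU UV(2) by auto
    have finZ: "finite Z" using finW finB by (simp add: Z_def)
    have cZ: "card Z = card W + card B" unfolding Z_def using finW finB WB by (rule card_Un_disjoint)
    have ZV: "Z \<subseteq> V" using W(1) BU UV(1) by (auto simp: Z_def)
    have Zk: "card Z < k" using False cZ by simp
    have dW: "d w \<ge> (2/3 - 5 * \<epsilon>) * n\<^sup>2" if w: "w \<in> W" for w
    proof -
      have "card B < card (N w)" using cN[OF w] Zk cZ k by linarith
      then have "\<not> N w \<subseteq> B" using card_mono[OF finB, of "N w"] by auto
      then obtain a where a: "a \<in> N w" "a \<notin> B" by auto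
      then have "a \<in> U" using NU[OF w] by auto
      then have "d a < (2/3 + 3 * \<epsilon>) * n\<^sup>2" using a(2) by (simp add: B_def)
      then have "real (card (lk E a)) < (2/3 + 3 * \<epsilon>) * n\<^sup>2" using dE[of a] by linarith
      moreover have "(4/3 - 2 * \<epsilon>) * n\<^sup>2 \<le> real (card (lk E w)) + real (card (lk E a))"
        using adj[of w a] a(1) by (simp add: N_def n_def)
      ultimately have "(2/3 - 5 * \<epsilon>) * n\<^sup>2 \<le> real (card (lk E w))" by (simp add: algebra_simps)
      then show ?thesis using dE[of w] by linarith
    qed
    have edge_Z: "{z, u, u'} \<in> F" if z: "z \<in> Z" and u: "u \<in> U" "u' \<in> U" "distinct [z, u, u']" for z u u'
    proof (cases "z \<in> B")
      case True
      then show ?thesis using edge_B u by simp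
    next
      case False
      then have zW: "z \<in> W" using z by (simp add: Z_def)
      have "d z + d u + d u' > (2 - 10 * \<epsilon>) * n\<^sup>2"
        using dW[OF zW] dU[OF u(1)] dU[OF u(2)] en by (simp add: algebra_simps)
      then show ?thesis using zW W(1) u by (intro edge_sum) auto
    qed
    \<comment> \<open>Adding all triples that meet \<open>Z\<close> makes every degree large, so
      \<open>dense\<close> applies. At most \<open>card Z\<close> edges of the resulting matching
      meet \<open>Z\<close>; \<open>k - card Z\<close> of the others are kept, and stars at
      \<open>Z\<close> use up the remaining \<open>2 * card Z\<close> vertices.\<close>
    define F' where "F' = F \<union> {e. e \<subseteq> V \<and> card e = 3 \<and> e \<inter> Z \<noteq> {}}"
    have tgF': "three_graph V F'" using tgF by (auto simp: F'_def three_graph_def)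
    have "real (card (lk F' v)) \<ge> (2/3 - 1/20000) * (real (card V))\<^sup>2" if v: "v \<in> V" for v
    proof (cases "v \<in> Z")
      case True
      have "(SIGMA p:V - {v}. V - {v} - {p}) \<subseteq> lk F' v"
        using v True by (auto simp: F'_def card3_iff)
      then have "card (SIGMA p:V - {v}. V - {v} - {p}) \<le> card (lk F' v)"
        using finite_lk[OF tgF'] by (intro card_mono)
      moreover have "card (SIGMA p:V - {v}. V - {v} - {p}) = (\<Sum>p\<in>V - {v}. card (V - {v} - {p}))"
        using finV by (intro card_SigmaI) auto
      moreover have "\<dots> = (\<Sum>p\<in>V - {v}. card V - 2)" using finV v by (intro sum.cong refl) simp
      moreover have "\<dots> = (card V - 1) * (card V - 2)" using v finV by simp
      ultimately have "(card V - 1) * (card V - 2) \<le> card (lk F' v)" by (simp only:)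
      then have "real ((card V - 1) * (card V - 2)) \<le> real (card (lk F' v))" by (rule of_nat_mono)
      moreover have "card V \<ge> 2" using large by simp
      ultimately have "(n - 1) * (n - 2) \<le> real (card (lk F' v))" unfolding n_def by (simp add: of_nat_diff)
      moreover have "(n - 1) * (n - 2) \<ge> n\<^sup>2 - 3 * n" by (simp add: algebra_simps power2_eq_square)
      ultimately show ?thesis using nn n1 unfolding n_def[symmetric] by (simp add: field_simps)
    next
      case False
      then have "v \<in> U" using v by (simp add: Z_def U_def)
      then have "d v \<ge> (2/3 - \<epsilon>) * n\<^sup>2" by (rule dU)
      moreover have "(2/3 - \<epsilon>) * n\<^sup>2 \<ge> (2/3 - 1/20000) * n\<^sup>2"
        unfolding \<epsilon>_def by (intro mult_right_mono) auto
      moreover have "card (lk F v) \<le> card (lk F' v)"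
        using finite_lk[OF tgF'] lk_mono[of F F' v] by (intro card_mono) (auto simp: F'_def)
      then have "d v \<le> real (card (lk F' v))" unfolding d_def by simp
      ultimately show ?thesis unfolding n_def[symmetric] by linarith
    qed
    then obtain M where M: "matching F' M" "3 * card M = card V" using dense[OF tgF'] by auto
    have finM: "finite M" by (rule matching_finite[OF tgF' M(1)])
    have cM: "card M = k" using M(2) k by simp
    have Mdis: "disjoint M" using M(1) by (simp add: matching_def)
    let ?MA = "{e \<in> M. e \<inter> Z = {}}"
    have "?MA \<union> {e \<in> M. e \<inter> Z \<noteq> {}} = M" by auto
    then have "card M \<le> card ?MA + card {e \<in> M. e \<inter> Z \<noteq> {}}"
      using card_Un_le[of ?MA "{e \<in> M. e \<inter> Z \<noteq> {}}"] by (simp only:)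
    then have "k - card Z \<le> card ?MA" using cM card_meeting_le[OF Mdis finZ] by linarith
    then obtain M1 where M1: "M1 \<subseteq> ?MA" "card M1 = k - card Z" by (rule obtain_subset_with_card_n)
    have "?MA \<subseteq> F" using M(1) unfolding matching_def F'_def by auto
    moreover have "disjoint M1" by (rule pairwise_subset[OF Mdis]) (use M1(1) in auto)
    ultimately have mM1: "matching F M1" using M1(1) unfolding matching_def by auto
    note U1 = matching_card_Union[OF tgF mM1]
    define Y where "Y = V - (Z \<union> \<Union>M1)"
    have ZM1: "Z \<inter> \<Union>M1 = {}" using M1(1) by auto
    have "card (Z \<union> \<Union>M1) = card Z + 3 * (k - card Z)"
      using ZM1 finZ U1(1,3) M1(2) by (simp add: card_Un_disjoint)
    then have cY: "card Y = 2 * card Z"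
      unfolding Y_def using k Zk ZV U1(2,3) finZ by (simp add: card_Diff_subset)
    have YU: "Y \<subseteq> U" by (auto simp: Y_def U_def Z_def)
    have finY: "finite Y" using finV by (simp add: Y_def)
    have ZY: "Z \<inter> Y = {}" by (auto simp: Y_def)
    have "{z, y, y'} \<in> F" if "z \<in> Z" "y \<in> Y" "y' \<in> Y" "y \<noteq> y'" for z y y'
    proof -
      have "z \<noteq> y" "z \<noteq> y'" using that ZY by auto
      then show ?thesis using that YU by (intro edge_Z) auto
    qed
    then obtain M2 where M2: "matching F M2" "card M2 = card Z" "\<Union>M2 = Z \<union> Y"
      by (rule complete_star_matching[OF finZ finY ZY cY]) blast
    have "\<Union>M2 \<inter> \<Union>(M1 - {}) = {}" unfolding M2(3) using ZM1 by (auto simp: Y_def)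
    note rep = matching_replace[OF tgF mM1 _ M2(1) this]
    have "matching F (M1 \<union> M2)" "card (M1 \<union> M2) = k" using rep M1(2) M2(2) Zk by simp_all
    then show False using noF unfolding k_def by auto
  qed
qed

text \<open>After covering \<open>W\<close> greedily, deletion of the \<open>3 * card W\<close>
  covered vertices costs each link at most 6/200000 of the square of \<open>card V\<close>. This is
  less than \<open>1/20000 - \<epsilon>\<close>, so the dense case applies to the rest.\<close>

lemma perfect_matching_few_exceptional:
  fixes V :: "'a set"
  defines "\<epsilon> \<equiv> 1 / 10 ^ 12 :: real"
  assumes dense: "\<And>(V' :: 'a set) E'. three_graph V' E' \<Longrightarrow> card V' \<ge> n0 \<Longrightarrow> 3 dvd card V' \<Longrightarrow>
       (\<forall>v\<in>V'. real (card (lk E' v)) \<ge> (2/3 - 1/20000) * (real (card V'))\<^sup>2) \<Longrightarrow>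
       \<exists>M. matching E' M \<and> 3 * card M = card V'"
    and tg: "three_graph V E" and dv: "3 dvd card V" and large: "card V \<ge> 2 * n0" "card V > 0"
    and W: "W \<subseteq> V" "200000 * card W \<le> card V"
    and leg: "\<And>e. e \<in> E \<Longrightarrow> card (e \<inter> W) \<le> 1"
    and degU: "\<And>u. u \<in> V - W \<Longrightarrow> real (card (lk E u)) \<ge> (2/3 - \<epsilon>) * (real (card V))\<^sup>2"
    and degW: "\<And>w. w \<in> W \<Longrightarrow> real (card (lk E w)) \<ge> (real (card V))\<^sup>2 / 4"
  shows "\<exists>M. matching E M \<and> 3 * card M = card V"
proof -
  define n where "n = real (card V)"
  have finV: "finite V" using tg by (simp add: three_graph_def)
  have npos: "n\<^sup>2 > 0" using large unfolding n_def by simp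
  have "200000 * card W * card V \<le> card V * card V" using W(2) by (intro mult_right_mono) auto
  then have "real (200000 * card W * card V) \<le> real (card V * card V)" by (rule of_nat_mono)
  then have Wn: "200000 * (real (card W) * n) \<le> n\<^sup>2" by (simp add: n_def power2_eq_square)
  have "6 * card W * card V < card (lk E w)" if "w \<in> W" for w
  proof -
    have "real (6 * card W * card V) = 6 * (real (card W) * n)" by (simp add: n_def)
    also have "\<dots> < n\<^sup>2 / 4" using Wn npos by linarith
    also have "\<dots> \<le> real (card (lk E w))" using degW[OF that] by (simp add: n_def)
    finally show ?thesis by (rule of_nat_less_iff[THEN iffD1])
  qed
  then obtain M0 where M0: "matching E M0" "card M0 = card W" "W \<subseteq> \<Union>M0"
    using greedy_cover[OF tg W(1) leg] by blast
  note U0 = matching_card_Union[OF tg M0(1)]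
  define V' where "V' = V - \<Union>M0"
  define E' where "E' = {e \<in> E. e \<subseteq> V'}"
  have V': "V' \<subseteq> V" "V - V' = \<Union>M0" using U0(2) by (auto simp: V'_def)
  have cV': "card V' = card V - 3 * card W" unfolding V'_def using U0 M0(2) by (simp add: card_Diff_subset)
  have tg': "three_graph V' E'" unfolding E'_def by (rule three_graph_induced[OF tg V'(1)])
  have dv': "3 dvd card V'" unfolding cV' using dv by (intro dvd_diff_nat) auto
  have large': "card V' \<ge> n0" unfolding cV' using large W(2) by linarith
  have "real (card (lk E' v)) \<ge> (2/3 - 1/20000) * (real (card V'))\<^sup>2" if v: "v \<in> V'" for v
  proof -
    have "card (lk E v) \<le> card (lk E' v) + 2 * (3 * card W) * card V"
      using card_lk_induced[OF tg V'(1) v] V'(2) U0(1) M0(2) unfolding E'_def by simp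
    then have "real (card (lk E v)) \<le> real (card (lk E' v) + 2 * (3 * card W) * card V)" by (rule of_nat_mono)
    then have 1: "real (card (lk E v)) \<le> real (card (lk E' v)) + 6 * (real (card W) * n)" by (simp add: n_def)
    have "v \<in> V - W" using v M0(3) by (auto simp: V'_def)
    then have 2: "(2/3 - \<epsilon>) * n\<^sup>2 \<le> real (card (lk E v))" using degU by (simp add: n_def)
    have "(real (card V'))\<^sup>2 \<le> n\<^sup>2" unfolding n_def cV' by (intro power_mono) auto
    then have "(2/3 - 1/20000) * (real (card V'))\<^sup>2 \<le> (2/3 - 1/20000) * n\<^sup>2" by (intro mult_left_mono) auto
    also have "\<dots> \<le> real (card (lk E' v))" using 1 2 Wn npos unfolding \<epsilon>_def by (simp add: field_simps)
    finally show ?thesis .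
  qed
  then obtain M1 where M1: "matching E' M1" "3 * card M1 = card V'" using dense[OF tg' large' dv'] by auto
  have "matching E M1" using M1(1) by (auto simp: matching_def E'_def)
  moreover have "\<Union>M1 \<inter> \<Union>(M0 - {}) = {}"
    using matching_card_Union(2)[OF tg' M1(1)] by (auto simp: V'_def)
  ultimately have "matching E (M0 - {} \<union> M1)" "card (M0 - {} \<union> M1) = card M0 - card {} + card M1"
    using matching_replace[OF tg M0(1), of "{}" M1] by simp_all
  then have "matching E (M0 \<union> M1)" "card (M0 \<union> M1) = card W + card M1" using M0(2) by simp_all
  moreover have "3 * (card W + card M1) = card V" using M1(2) cV' W(2) by simp
  ultimately show ?thesis by auto
qed

section \<open>From degree sums of adjacent vertices to the three cases\<close>

lemma sigma2'_le:
  assumes tg: "three_graph V E" and "hadjacent E u v"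
  shows "sigma2' E \<le> hdegree E u + hdegree E v"
proof -
  have "{hdegree E u + hdegree E v | u v. hadjacent E u v} \<subseteq> (\<lambda>(u, v). hdegree E u + hdegree E v) ` (V \<times> V)"
    using tg by (fastforce simp: hadjacent_def three_graph_def)
  moreover have "finite ((\<lambda>(u, v). hdegree E u + hdegree E v) ` (V \<times> V))"
    using tg by (simp add: three_graph_def)
  ultimately have "finite {hdegree E u + hdegree E v | u v. hadjacent E u v}" by (rule finite_subset)
  then show ?thesis unfolding sigma2'_def using assms(2) by (intro Min_le) auto
qed

text \<open>A set that every edge meets at most once serves as \<open>S\<close> after being cut down
  to the exact size.\<close>

lemma sub_HstarI:
  assumes tg: "three_graph V E" and dv: "3 dvd card V" and pos: "card V > 0"
    and W: "W \<subseteq> V" "card W \<ge> card V div 3 + 1" and leg: "\<And>e. e \<in> E \<Longrightarrow> card (e \<inter> W) \<le> 1"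
  shows "sub_Hstar V E"
proof -
  obtain S where S: "S \<subseteq> W" "card S = card V div 3 + 1" "finite S"
    using W(2) by (rule obtain_subset_with_card_n)
  obtain k where k: "card V = 3 * k" using dv by blast
  have finV: "finite V" using tg by (simp add: three_graph_def)
  have SV: "S \<subseteq> V" using S(1) W(1) by auto
  have cT: "card (V - S) = 3 * k - (k + 1)" using S(2,3) SV k by (simp add: card_Diff_subset)
  have "k \<ge> 1" using pos k by simp
  then have "real (card (V - S)) = 2 * real k - 1" unfolding cT by (simp add: of_nat_diff)
  then have "real (card (V - S)) = 2 * real (card V) / 3 - 1" using k by simp
  moreover have "real (card S) = real (card V) / 3 + 1" using S(2) k by simp
  moreover have "E \<subseteq> Hstar_edges S (V - S)"
  proof
    fix e assume e: "e \<in> E"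
    then have eV: "e \<subseteq> V" "card e = 3" using tg by (auto simp: three_graph_def)
    have fine: "finite e" using eV(1) finV by (rule finite_subset)
    have "card (e \<inter> S) \<le> card (e \<inter> W)" using fine S(1) by (intro card_mono) auto
    then have "card (e \<inter> S) \<le> 1" using leg[OF e] by simp
    moreover have "e \<inter> (V - S) = e - e \<inter> S" using eV(1) by auto
    then have "card (e \<inter> (V - S)) = 3 - card (e \<inter> S)" using fine eV(2) by (simp add: card_Diff_subset)
    ultimately have "card (e \<inter> (V - S)) \<ge> 2" by simp
    then show "e \<in> Hstar_edges S (V - S)" using eV by (auto simp: Hstar_edges_def)
  qed
  ultimately show ?thesis unfolding sub_Hstar_def
    using SV by (intro exI[of _ S] exI[of _ "V - S"]) auto
qed

theorem theorem1p2:
  "\<exists>\<epsilon>::real. \<epsilon> > 0 \<and> (\<exists>n0::nat. \<forall>n\<ge>n0. 3 dvd n \<longrightarrow>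
     (\<forall>(V :: 'a set) E. three_graph V E \<longrightarrow> card V = n \<longrightarrow>
        (\<forall>v\<in>V. hdegree E v \<noteq> 0) \<longrightarrow>
        real (sigma2' E) > 2 / 3 * (real n)\<^sup>2 - \<epsilon> * (real n)\<^sup>2 \<longrightarrow>
        sub_Hstar V E \<or> (\<exists>M. perfect_matching V E M)))"
proof -
  obtain n0 where dense0: "\<forall>(V :: 'a set) E. three_graph V E \<longrightarrow> card V \<ge> n0 \<longrightarrow> 3 dvd card V \<longrightarrow>
     (\<forall>v\<in>V. real (card (lk E v)) \<ge> (2/3 - 1/20000) * (real (card V))\<^sup>2) \<longrightarrow>
     (\<exists>M. matching E M \<and> 3 * card M = card V)"
    using dense_perfect_matching by blast
  then have dense: "\<exists>M. matching E M \<and> 3 * card M = card V"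
    if "three_graph V E" "card V \<ge> n0" "3 dvd card V"
      "\<forall>v\<in>V. real (card (lk E v)) \<ge> (2/3 - 1/20000) * (real (card V))\<^sup>2" for V :: "'a set" and E
    using that by simp
  define \<epsilon> :: real where "\<epsilon> = 1 / 10 ^ 12"
  have "sub_Hstar V E \<or> (\<exists>M. perfect_matching V E M)"
    if big: "card V \<ge> max (10 ^ 14) (2 * n0)" and dv: "3 dvd card V" and tg: "three_graph V E"
      and niso: "\<forall>v\<in>V. hdegree E v \<noteq> 0"
      and sigma: "real (sigma2' E) > 2 / 3 * (real (card V))\<^sup>2 - \<epsilon> * (real (card V))\<^sup>2"
    for V :: "'a set" and E
  proof -
    let ?n = "real (card V)"
    have big1: "card V \<ge> 10 ^ 14" and big2: "card V \<ge> 2 * n0" using big by (auto simp: max_def split: if_splits)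
    have pos: "card V > 0" using big1 by (rule order.strict_trans2[rotated]) simp
    have npos: "?n\<^sup>2 > 0" using pos by simp
    have finV: "finite V" using tg by (simp add: three_graph_def)
    \<comment> \<open>Links count edges twice, which doubles the threshold.\<close>
    have adj: "real (card (lk E u)) + real (card (lk E v)) > (4/3 - 2 * \<epsilon>) * ?n\<^sup>2" if "hadjacent E u v" for u v
    proof -
      have "real (sigma2' E) \<le> real (hdegree E u + hdegree E v)" using sigma2'_le[OF tg that] by (rule of_nat_mono)
      then have "2 / 3 * ?n\<^sup>2 - \<epsilon> * ?n\<^sup>2 < real (hdegree E u) + real (hdegree E v)" using sigma by simp
      then show ?thesis unfolding card_lk[OF tg] by (simp add: algebra_simps)
    qed
    \<comment> \<open>Two vertices of \<open>W\<close> stay below the bound for adjacent vertices,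
      so no edge contains both.\<close>
    define W where "W = {v \<in> V. real (card (lk E v)) < (2/3 - \<epsilon>) * ?n\<^sup>2}"
    have WV: "W \<subseteq> V" by (auto simp: W_def)
    have leg: "card (e \<inter> W) \<le> 1" if e: "e \<in> E" for e
    proof (rule ccontr)
      assume "\<not> card (e \<inter> W) \<le> 1"
      then have "2 \<le> card (e \<inter> W)" by simp
      then obtain X where X: "X \<subseteq> e \<inter> W" "card X = 2" by (rule obtain_subset_with_card_n)
      then obtain u v where "X = {u, v}" "u \<noteq> v" by (auto simp: card_2_iff)
      then have uv: "u \<in> e" "v \<in> e" "u \<in> W" "v \<in> W" "u \<noteq> v" using X(1) by auto
      then have "hadjacent E u v" using e by (auto simp: hadjacent_def)
      from adj[OF this] uv(3,4) show False unfolding W_def by (simp add: algebra_simps)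
    qed
    have nonempty: "lk E w \<noteq> {}" if "w \<in> V" for w
      using niso that card_lk[OF tg, of w] by force
    have degU: "real (card (lk E u)) \<ge> (2/3 - \<epsilon>) * ?n\<^sup>2" if "u \<in> V - W" for u
      using that by (auto simp: W_def)
    \<comment> \<open>The ratio 200000 separates sets small enough to be covered greedily from those
      where a saving quadratic in \<open>card W\<close> beats the error terms.\<close>
    consider "card W \<ge> card V div 3 + 1" | "3 * card W \<le> card V" "200000 * card W \<le> card V"
      | "3 * card W \<le> card V" "card V \<le> 200000 * card W" using dv by fastforce
    then show ?thesis
    proof cases
      case 1
      then show ?thesis using sub_HstarI[OF tg dv pos WV _ leg] by simp
    next
      case 2
      \<comment> \<open>A vertex \<open>w\<close> that is not isolated has a neighbour, whose link
        has at most \<open>?n\<^sup>2\<close> pairs, so almost a third remains for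
        \<open>w\<close>.\<close>
      have degW: "real (card (lk E w)) \<ge> ?n\<^sup>2 / 4" if w: "w \<in> W" for w
      proof -
        obtain x where x: "x \<in> lk E w" using nonempty w WV by fast
        obtain p q where "x = (p, q)" by (cases x)
        then have e: "{w, p, q} \<in> E" using x by simp
        then have "hadjacent E w p" using three_graph_edge(1)[OF tg e] unfolding hadjacent_def by auto
        from adj[OF this] have a: "(4/3 - 2 * \<epsilon>) * ?n\<^sup>2 < real (card (lk E w)) + real (card (lk E p))" .
        have "real (card (lk E p)) \<le> real (card V * card V)" using card_lk_le[OF tg, of p] by (rule of_nat_mono)
        then have "real (card (lk E p)) \<le> ?n\<^sup>2" by (simp add: power2_eq_square)
        moreover have "N / 4 \<le> a" if "(4/3 - 2 * \<epsilon>) * N < a + b" "b \<le> N" "N > 0" for N a b :: real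
          using that unfolding \<epsilon>_def by (simp add: algebra_simps)
        ultimately show ?thesis using a npos by blast
      qed
      have "\<exists>M. matching E M \<and> 3 * card M = card V"
        by (rule perfect_matching_few_exceptional[OF dense tg dv big2 pos WV 2(2) leg])
          (use degU degW in \<open>simp_all add: \<epsilon>_def\<close>)
      then show ?thesis using perfect_matchingI[OF tg] by blast
    next
      case 3
      have n0: "card V \<ge> n0" using big2 by simp
      have "\<exists>M. matching E M \<and> card M = card V div 3"
      proof (rule perfect_matching_many_exceptional[OF dense[OF _ n0 dv] tg dv big1 WV 3(2,1) leg])
        show "(2 / 3 - 1 / 10 ^ 12) * ?n\<^sup>2 \<le> real (card (lk E u))" if "u \<in> V - W" for u
          using degU[OF that] by (simp only: \<epsilon>_def)
        show "(4 / 3 - 2 * (1 / 10 ^ 12)) * ?n\<^sup>2 \<le> real (card (lk E u)) + real (card (lk E v))"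
          if "hadjacent E u v" for u v
          using less_imp_le[OF adj[OF that]] by (simp only: \<epsilon>_def)
        show "lk E w \<noteq> {}" if "w \<in> W" for w using nonempty that WV by auto
      qed
      then obtain M where "matching E M" "card M = card V div 3" by auto
      moreover have "3 * (card V div 3) = card V" using dv by simp
      ultimately show ?thesis using perfect_matchingI[OF tg, of M] by auto
    qed
  qed
  moreover have "\<epsilon> > 0" by (simp add: \<epsilon>_def)
  ultimately show ?thesis
    by (intro exI[of _ \<epsilon>] conjI exI[of _ "max (10 ^ 14) (2 * n0)"]) auto
qed

end
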